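(* Let $\mathbb{X}$ be one of $\mathbb{S}^3$ (unit sphere, curvature $1$), $\mathbb{H}^3$ (hyperbolic space, curvature $-1$), or $\mathbb{E}^3$ (Euclidean space). Let $\Delta$ be a tetrahedron in $\mathbb{X}$ with vertices $F_1, F_2, K, L$ and edge lengths $$|F_1F_2| = x,\quad |KL| = y,\quad |F_1K| = a,\quad |F_2K| = b,\quad |F_2L| = c,\quad |F_1L| = d.$$ Put $s = \frac{a+b+c+d}{2}$, and let $\bar\Delta$ be the tetrahedron in $\mathbb{X}$ with vertices $G_1, G_2, M, N$ and edge lengths $$|G_1G_2| = x,\quad |MN| = y,\quad |G_1M| = s-a,\quad |G_2M| = s-b,\quad |G_2N| = s-c,\quad |G_1N| = s-d.$$ Then the solid angles of $\Delta$ at $F_1, F_2, K, L$ are equal to the solid angles of $\bar\Delta$ at $G_2, G_1, N, M$ respectively. (That is, the solid angle at the vertex of $\Delta$ incident to the edges $(x,a,d)$ equals the solid angle at the vertex of $\bar\Delta$ incident to the edges $(x,s-b,s-c)$, and similarly for the pairs of vertices $(x,b,c)$ and $(x,s-a,s-d)$, $(y,a,b)$ and $(y,s-c,s-d)$, $(y,c,d)$ and $(y,s-a,s-b)$.)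
   Context: Tetrahedra are non-degenerate geodesic tetrahedra: the four vertices do not lie in a common (totally geodesic) plane; in the spherical case, the vertices are linearly independent unit vectors in $\mathbb{R}^4$, the tetrahedron is the intersection of $\mathbb{S}^3$ with the convex cone they span, and edge lengths are in $(0,\pi)$. The solid angle of a tetrahedron at a vertex is the area of the spherical triangle cut out of the unit sphere of the tangent space at that vertex by the directions pointing into the tetrahedron; it equals the sum of the three dihedral angles at the edges incident to the vertex minus $\pi$. A tetrahedron $\bar\Delta$ with the given edge lengths always exists and is unique up to isometry. *)

theory Defs
  imports "HOL-Analysis.Analysis"
begin

datatype geometry = Spherical | Hyperbolic | Euclidean

text \<open>
  All three spaces are realised as hypersurfaces of \<open>real^4\<close>: the unit sphere, the upper sheet of
  the hyperboloid (coordinate 1 is the timelike one), and the affine hyperplane \<open>x $ 1 = 1\<close>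
  with its Euclidean metric.
\<close>

fun form :: "geometry \<Rightarrow> real^4 \<Rightarrow> real^4 \<Rightarrow> real" where
  "form Spherical u v = u \<bullet> v"
| "form Hyperbolic u v = u $ 2 * v $ 2 + u $ 3 * v $ 3 + u $ 4 * v $ 4 - u $ 1 * v $ 1"
| "form Euclidean u v = u \<bullet> v"

fun points :: "geometry \<Rightarrow> (real^4) set" where
  "points Spherical = {p. form Spherical p p = 1}"
| "points Hyperbolic = {p. form Hyperbolic p p = -1 \<and> p $ 1 > 0}"
| "points Euclidean = {p. p $ 1 = 1}"

fun gdist :: "geometry \<Rightarrow> real^4 \<Rightarrow> real^4 \<Rightarrow> real" where
  "gdist Spherical p q = arccos (form Spherical p q)"
| "gdist Hyperbolic p q = arcosh (- form Hyperbolic p q)"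
| "gdist Euclidean p q = dist p q"

fun tangent_space :: "geometry \<Rightarrow> real^4 \<Rightarrow> (real^4) set" where
  "tangent_space Spherical p = {v. form Spherical p v = 0}"
| "tangent_space Hyperbolic p = {v. form Hyperbolic p v = 0}"
| "tangent_space Euclidean p = {v. v $ 1 = 0}"

text \<open>The restriction of \<open>form g\<close> is positive definite on each of these tangent spaces.\<close>

definition unit_tangent_sphere :: "geometry \<Rightarrow> real^4 \<Rightarrow> (real^4) set" where
  "unit_tangent_sphere g p = {v \<in> tangent_space g p. form g v v = 1}"

text \<open>\<open>geodesic g p v\<close> is the unit speed geodesic from \<open>p\<close> with initial velocity \<open>v\<close>.\<close>

fun geodesic :: "geometry \<Rightarrow> real^4 \<Rightarrow> real^4 \<Rightarrow> real \<Rightarrow> real^4" where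
  "geodesic Spherical p v t = cos t *\<^sub>R p + sin t *\<^sub>R v"
| "geodesic Hyperbolic p v t = cosh t *\<^sub>R p + sinh t *\<^sub>R v"
| "geodesic Euclidean p v t = p + t *\<^sub>R v"

definition geodesic_plane :: "geometry \<Rightarrow> (real^4) set \<Rightarrow> bool" where
  "geodesic_plane g P \<longleftrightarrow> P \<noteq> {} \<and> (\<exists>W. subspace W \<and> dim W = 3 \<and> P = points g \<inter> W)"

definition tetrahedron :: "geometry \<Rightarrow> real^4 \<Rightarrow> real^4 \<Rightarrow> real^4 \<Rightarrow> real^4 \<Rightarrow> bool" where
  "tetrahedron g A B C D \<longleftrightarrow>
     {A, B, C, D} \<subseteq> points g \<and> \<not> (\<exists>P. geodesic_plane g P \<and> {A, B, C, D} \<subseteq> P)"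

definition region :: "geometry \<Rightarrow> real^4 \<Rightarrow> real^4 \<Rightarrow> real^4 \<Rightarrow> real^4 \<Rightarrow> (real^4) set" where
  "region g A B C D = points g \<inter> convex_cone hull {A, B, C, D}"

definition inward_directions :: "geometry \<Rightarrow> (real^4) set \<Rightarrow> real^4 \<Rightarrow> (real^4) set" where
  "inward_directions g T p =
     {v \<in> unit_tangent_sphere g p. \<forall>\<^sub>F t in at_right 0. geodesic g p v t \<in> T}"

text \<open>
  The area of a subset of the unit sphere of \<open>real^3\<close>: a cone over the sphere with apex 0 and
  radius 1 has volume one third of the area of its base.
\<close>

definition sphere_area :: "(real^3) set \<Rightarrow> real" where
  "sphere_area S = 3 * measure lebesgue {r *\<^sub>R u | r u. 0 \<le> r \<and> r \<le> 1 \<and> u \<in> S}"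

definition tangent_frame :: "geometry \<Rightarrow> real^4 \<Rightarrow> (real^3 \<Rightarrow> real^4) \<Rightarrow> bool" where
  "tangent_frame g p \<phi> \<longleftrightarrow>
     linear \<phi> \<and> range \<phi> = tangent_space g p \<and> (\<forall>u v. form g (\<phi> u) (\<phi> v) = u \<bullet> v)"

text \<open>
  Areas in a tangent space are transported from \<open>real^3\<close> along a linear isometry; Lebesgue measure
  is invariant under orthogonal maps, so the choice of the isometry does not matter.
\<close>

definition solid_angle :: "geometry \<Rightarrow> (real^4) set \<Rightarrow> real^4 \<Rightarrow> real" where
  "solid_angle g T p =
     sphere_area ((SOME \<phi>. tangent_frame g p \<phi>) -` inward_directions g T p)"


lemma tetrahedron_iff_independent:
  "tetrahedron g A B C D \<longleftrightarrow>
     {A, B, C, D} \<subseteq> points g \<and> distinct [A, B, C, D] \<and> independent {A, B, C, D}"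
proof -
  let ?V = "{A, B, C, D}"
  have card_le: "card ?V \<le> 4"
    by (simp add: card_insert_if)
  have card4: "card ?V = 4 \<longleftrightarrow> distinct [A, B, C, D]"
  proof -
    have "card (set [A, B, C, D]) = length [A, B, C, D] \<longleftrightarrow> distinct [A, B, C, D]"
      using card_distinct distinct_card by blast
    then show ?thesis
      by (simp add: eval_nat_numeral)
  qed
  have "(\<exists>P. geodesic_plane g P \<and> ?V \<subseteq> P) \<longleftrightarrow> span ?V \<noteq> UNIV" if V: "?V \<subseteq> points g"
  proof
    assume "\<exists>P. geodesic_plane g P \<and> ?V \<subseteq> P"
    then obtain W where "subspace W" "dim W = 3" "?V \<subseteq> W"
      unfolding geodesic_plane_def by blast
    then have "dim (span ?V) \<le> 3"
      using dim_subset[of ?V W] by (simp only: dim_span)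
    moreover have "dim (UNIV :: (real^4) set) = 4"
      by simp
    ultimately show "span ?V \<noteq> UNIV"
      by fastforce
  next
    assume "span ?V \<noteq> UNIV"
    then obtain a where a: "a \<noteq> 0" "span ?V \<subseteq> {x. a \<bullet> x = 0}"
      using span_not_univ_subset_hyperplane by blast
    let ?H = "{x. a \<bullet> x = 0}"
    have sub: "?V \<subseteq> points g \<inter> ?H"
      using a(2) V span_superset[of ?V] by blast
    moreover have "subspace ?H" "dim ?H = 3"
      using a(1) by (simp_all add: subspace_hyperplane dim_hyperplane)
    ultimately have "geodesic_plane g (points g \<inter> ?H)"
      unfolding geodesic_plane_def by blast
    with sub show "\<exists>P. geodesic_plane g P \<and> ?V \<subseteq> P"
      by blast
  qed
  moreover have "span ?V = UNIV \<longleftrightarrow> card ?V = 4 \<and> independent ?V"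
  proof
    assume sp: "span ?V = UNIV"
    then have "dim ?V = 4"
      using dim_span[of ?V] by simp
    then show "card ?V = 4 \<and> independent ?V"
      using card_le dim_le_card'[of ?V] card_le_dim_spanning[of ?V UNIV] sp by simp
  next
    assume "card ?V = 4 \<and> independent ?V"
    then show "span ?V = UNIV"
      using card_ge_dim_independent[of ?V UNIV] by auto
  qed
  ultimately show ?thesis
    unfolding tetrahedron_def card4[symmetric] by blast
qed

lemma region_Euclidean:
  assumes "{A, B, C, D} \<subseteq> points Euclidean"
  shows "region Euclidean A B C D = convex hull {A, B, C, D}"
proof -
  let ?V = "{A, B, C, D}"
  have "convex hull ?V \<subseteq> points Euclidean"
    using assms by (intro hull_minimal) (auto simp: convex_def)
  moreover have "convex_cone hull ?V = {c *\<^sub>R x | c x. 0 \<le> c \<and> x \<in> convex hull ?V}"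
    by (simp add: convex_cone_hull_separate_nonempty conic_hull_explicit)
  moreover have "convex hull ?V \<subseteq> convex_cone hull ?V"
    by (rule convex_hull_subset_convex_cone_hull)
  ultimately show ?thesis
    unfolding region_def by fastforce
qed

end

theory Submission
  imports Defs
begin

text \<open>
  The solid angle of a tetrahedron at a vertex is the area of the spherical triangle of inward
  directions, and its sides are the angles that the three edges at this vertex make with each other.
  If \<open>p\<close>, \<open>q\<close>, \<open>r\<close> are the cosines of the sides, the area is
    \<open>2 * arccos ((1 + p + q + r) / sqrt (2 * ((1 + p) * (1 + q) * (1 + r))))\<close>
  (\<open>ball_volume_cone\<close>). So the theorem is an identity between edge lengths, and dihedral angles do
  not occur in it.

  The area formula follows from Girard's theorem (\<open>girard\<close>): multiplying the complex numbers whose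
  arguments are the three angles of the triangle gives a negative multiple of a square, and the
  argument of its root is half the area. Girard's theorem itself is inclusion and exclusion for
  wedges between two planes, and the volume of a wedge is proportional to its angle because it is
  additive and bounded.

  The three geometries are treated together. With \<open>gsin\<close> standing for \<open>sin\<close>, \<open>sinh\<close> or the identity, the
  law of cosines says that the cosine \<open>r\<close> of the angle between sides \<open>x\<close> and \<open>a\<close> opposite to \<open>b\<close> satisfies
    \<open>(1 + r) * (gsin x * gsin a) = 2 * gsin ((x + a + b) / 2) * gsin ((x + a - b) / 2)\<close>
  (\<open>law_of_cosines\<close>). Inserting this in the area formula at a vertex with edges \<open>x\<close>, \<open>a\<close>, \<open>d\<close> turns the
  radicand into a product of six values of \<open>gsin\<close>, up to a square that cancels. The exchange of
  \<open>a\<close>, \<open>b\<close>, \<open>c\<close>, \<open>d\<close> with \<open>s - b\<close>, \<open>s - a\<close>, \<open>s - d\<close>, \<open>s - c\<close> permutes these factors, and the numerator is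
  invariant by the addition formulas, or by expansion in the Euclidean case (\<open>excess_regge\<close>).
\<close>

section \<open>Volumes of lunes\<close>

definition open_half :: "real^3 \<Rightarrow> (real^3) set" where
  "open_half n = {x. 0 < n \<bullet> x}"

text \<open>
  The ball truncates every cone to finite measure while keeping the rotational symmetry.
\<close>

definition ball_volume :: "(real^3) set \<Rightarrow> real" where
  "ball_volume S = measure lebesgue (cball 0 1 \<inter> S)"

lemma open_open_half [simp]: "open (open_half n)"
  by (simp add: open_half_def open_halfspace_gt)

lemma open_half_pos_scaleR:
  assumes "0 < r"
  shows "open_half (r *\<^sub>R n) = open_half n"
  using assms by (simp add: open_half_def zero_less_mult_iff)

lemma lmeasurable_ball_Int_open:
  fixes S :: "(real^3) set"
  assumes "open S"
  shows "cball 0 1 \<inter> S \<in> lmeasurable"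
  using assms by (simp add: fmeasurable_Int_fmeasurable borel_open)

lemma ball_volume_nonneg: "0 \<le> ball_volume S"
  by (simp add: ball_volume_def)

lemma ball_volume_UNIV: "ball_volume UNIV = 4 * pi / 3"
  using content_cball[of 1 "0::real^3"] by (simp add: ball_volume_def unit_ball_vol_3)

lemma ball_volume_le:
  assumes "open S"
  shows "ball_volume S \<le> 4 * pi / 3"
proof -
  have "ball_volume S \<le> ball_volume UNIV"
    unfolding ball_volume_def using assms lmeasurable_ball_Int_open[OF assms]
    by (intro measure_mono_fmeasurable) (auto intro: fmeasurableD)
  then show ?thesis
    by (simp add: ball_volume_UNIV)
qed

lemma ball_volume_negligible_diff:
  assumes "open S" "negligible (S - T \<union> (T - S))"
  shows "ball_volume T = ball_volume S"
  unfolding ball_volume_def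
proof (rule measure_negligible_symdiff)
  show "cball 0 1 \<inter> S \<in> lmeasurable"
    using assms by (simp add: lmeasurable_ball_Int_open)
  show "negligible (cball 0 1 \<inter> S - cball 0 1 \<inter> T \<union> (cball 0 1 \<inter> T - cball 0 1 \<inter> S))"
    by (rule negligible_subset[OF assms(2)]) auto
qed

lemma ball_volume_split:
  assumes "open S" "n \<noteq> 0"
  shows "ball_volume S = ball_volume (S \<inter> open_half n) + ball_volume (S \<inter> open_half (-n))"
proof -
  let ?U = "S \<inter> open_half n \<union> S \<inter> open_half (-n)"
  have op: "open (S \<inter> open_half n)" "open (S \<inter> open_half (-n))"
    using assms by auto
  have "negligible {x. n \<bullet> x = 0}"
    using assms by (simp add: negligible_hyperplane)
  then have "negligible (?U - S \<union> (S - ?U))"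
    by (rule negligible_subset) (auto simp: open_half_def)
  then have "ball_volume S = ball_volume ?U"
    using op by (intro ball_volume_negligible_diff) auto
  also have "\<dots> = ball_volume (S \<inter> open_half n) + ball_volume (S \<inter> open_half (-n))"
  proof -
    have "cball 0 1 \<inter> (S \<inter> open_half (-n)) - cball 0 1 \<inter> (S \<inter> open_half n)
        = cball 0 1 \<inter> (S \<inter> open_half (-n))"
      by (auto simp: open_half_def)
    then show ?thesis
      unfolding ball_volume_def Int_Un_distrib using measure_Un2[OF op[THEN lmeasurable_ball_Int_open]] by simp
  qed
  finally show ?thesis .
qed

lemma ball_volume_orthogonal_image:
  assumes f: "orthogonal_transformation f" and S: "open S"
  shows "ball_volume (f ` S) = ball_volume S"
proof -
  have inj: "inj f" and surj: "surj f"
    using f by (simp_all add: orthogonal_transformation_inj orthogonal_transformation_surj)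
  have "f -` cball 0 1 = cball 0 1"
    using f by (auto simp: orthogonal_transformation_norm)
  then have "f ` cball 0 1 = cball 0 1"
    using surj surj_image_vimage_eq by metis
  then have "cball 0 1 \<inter> f ` S = f ` (cball 0 1 \<inter> S)"
    using inj by (simp add: image_Int)
  then show ?thesis
    unfolding ball_volume_def using measure_orthogonal_image[OF f lmeasurable_ball_Int_open[OF S]] by simp
qed

lemma image_open_half:
  assumes f: "orthogonal_transformation f"
  shows "f ` open_half n = open_half (f n)"
proof -
  have "f n \<bullet> f x = n \<bullet> x" for x
    using f by (simp add: orthogonal_transformation_def)
  then have "f -` open_half (f n) = open_half n"
    by (simp add: open_half_def)
  then show ?thesis
    using orthogonal_transformation_surj[OF f] surj_image_vimage_eq by metis
qed

lemma ball_volume_wedge_image: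
  assumes f: "orthogonal_transformation f"
  shows "ball_volume (open_half (f m) \<inter> open_half (f n)) = ball_volume (open_half m \<inter> open_half n)"
proof -
  have "open_half (f m) \<inter> open_half (f n) = f ` (open_half m \<inter> open_half n)"
    using orthogonal_transformation_inj[OF f] by (simp add: image_Int image_open_half[OF f])
  then show ?thesis
    using ball_volume_orthogonal_image[OF f, of "open_half m \<inter> open_half n"] by (simp add: open_Int)
qed

lemma ball_volume_half:
  assumes "n \<noteq> 0"
  shows "ball_volume (open_half n) = 2 * pi / 3"
proof -
  have "orthogonal_transformation (\<lambda>x::real^3. - x)"
    by (simp add: orthogonal_transformation_neg)
  then have "ball_volume (open_half (-n)) = ball_volume (open_half n)"
    using ball_volume_wedge_image[of uminus n n] by simp
  then show ?thesis
    using ball_volume_split[of UNIV n] assms by (simp add: ball_volume_UNIV)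
qed

definition circle_point :: "real^3 \<Rightarrow> real^3 \<Rightarrow> real \<Rightarrow> real^3" where
  "circle_point e f t = cos t *\<^sub>R e + sin t *\<^sub>R f"

text \<open>
  Rotations of the plane of \<open>e\<close> and \<open>f\<close> are what makes the volume of a lune depend on its angle alone.
\<close>

lemma rotation_in_plane_exists:
  fixes e f :: "real^3"
  assumes "e \<bullet> e = 1" "f \<bullet> f = 1" "e \<bullet> f = 0"
  obtains R where "orthogonal_transformation R" "\<And>t. R (circle_point e f t) = circle_point e f (t + a)"
proof
  \<comment> \<open>The identity, corrected in the plane of \<open>e\<close> and \<open>f\<close> by a rotation through \<open>a\<close>.\<close>
  define R where "R x = x + (((cos a - 1) * (e \<bullet> x) - sin a * (f \<bullet> x)) *\<^sub>R e
      + (sin a * (e \<bullet> x) + (cos a - 1) * (f \<bullet> x)) *\<^sub>R f)" for x :: "real^3"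
  have fe: "f \<bullet> e = 0"
    using assms by (simp add: inner_commute)
  have "linear R"
    unfolding R_def by (rule linearI) (simp_all add: algebra_simps)
  moreover have "R v \<bullet> R v = v \<bullet> v" for v
  proof -
    define p q C S where pq: "p = e \<bullet> v" "q = f \<bullet> v" "C = cos a" "S = sin a"
    define X Y where XY: "X = (C - 1) * p - S * q" "Y = S * p + (C - 1) * q"
    have CS: "S^2 + C^2 = 1"
      by (simp add: pq)
    have "R v \<bullet> R v = v \<bullet> v + 2 * (X * p + Y * q) + X^2 + Y^2"
    proof -
      have "R v = v + (X *\<^sub>R e + Y *\<^sub>R f)"
        by (simp add: R_def pq XY)
      moreover have "v \<bullet> e = p" "v \<bullet> f = q"
        by (simp_all add: pq inner_commute)
      ultimately show ?thesis
        using assms fe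
        by (simp add: inner_add_left inner_add_right pq(1,2)[symmetric] power2_eq_square algebra_simps)
    qed
    also have "\<dots> = v \<bullet> v + (S^2 + C^2 - 1) * (p^2 + q^2)"
      unfolding XY by (simp add: algebra_simps power2_eq_square)
    finally show ?thesis
      by (simp add: CS)
  qed
  ultimately show "orthogonal_transformation R"
    by (simp add: orthogonal_transformation norm_eq_sqrt_inner)
  show "R (circle_point e f t) = circle_point e f (t + a)" for t
    unfolding R_def circle_point_def using assms fe
    by (simp add: cos_add sin_add algebra_simps)
qed

text \<open>
  Cauchy's equation on a bounded interval. The difference \<open>e\<close> of \<open>f\<close> and the candidate vanishes at \<open>T\<close>,
  so it is periodic with period \<open>T\<close>. Doubling the argument and reducing it modulo \<open>T\<close> doubles
  \<open>\<bar>e\<bar>\<close>, and a bounded function survives this only if it is zero.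
\<close>

lemma additive_bounded_linear:
  fixes f :: "real \<Rightarrow> real"
  assumes add: "\<And>s t. 0 < s \<Longrightarrow> 0 < t \<Longrightarrow> s + t < 2 * T \<Longrightarrow> f (s + t) = f s + f t"
    and bnd: "\<And>t. 0 < t \<Longrightarrow> t < 2 * T \<Longrightarrow> \<bar>f t\<bar> \<le> B"
    and t: "0 < t" "t < 2 * T"
  shows "f t = f T / T * t"
proof -
  have T: "0 < T"
    using t by linarith
  define e where "e s = f s - f T / T * s" for s
  have e_add: "e (r + s) = e r + e s" if "0 < r" "0 < s" "r + s < 2 * T" for r s
    using add[OF that] by (simp add: e_def algebra_simps add_divide_distrib)
  have eT: "e T = 0"
    using T by (simp add: e_def)
  define C where "C = B + \<bar>f T\<bar>"
  have e_bnd: "\<bar>e s\<bar> \<le> C" if "0 < s" "s < T" for s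
  proof -
    have "\<bar>f T / T * s\<bar> = \<bar>f T\<bar> * (s / T)"
      using that T by (simp add: abs_mult)
    also have "\<dots> \<le> \<bar>f T\<bar> * 1"
      using that by (intro mult_left_mono) auto
    finally show ?thesis
      using bnd[of s] that T unfolding e_def C_def by linarith
  qed
  have e_pow: "2 ^ n * \<bar>e s\<bar> \<le> C" if "0 < s" "s < T" for s n
    using that
  proof (induction n arbitrary: s)
    case 0
    then show ?case
      using e_bnd by simp
  next
    case (Suc n)
    have dbl: "e (2 * s) = 2 * e s"
      using e_add[of s s] Suc.prems by simp
    consider "2 * s < T" | "2 * s = T" | "T < 2 * s"
      by linarith
    then obtain r where "0 < r" "r < T" "\<bar>e r\<bar> \<ge> \<bar>2 * e s\<bar>"
    proof cases
      case 1
      then show ?thesis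
        using that[of "2 * s"] dbl Suc.prems by simp
    next
      case 2
      then show ?thesis
        using that[of s] dbl eT Suc.prems by simp
    next
      case 3
      then have "e (2 * s) = e (2 * s - T) + e T"
        using e_add[of "2 * s - T" T] Suc.prems T by simp
      then show ?thesis
        using that[of "2 * s - T"] 3 dbl eT Suc.prems by simp
    qed
    then have "2 ^ Suc n * \<bar>e s\<bar> \<le> 2 ^ n * \<bar>e r\<bar>"
      by (simp add: abs_mult)
    also have "\<dots> \<le> C"
      using Suc.IH \<open>0 < r\<close> \<open>r < T\<close> by blast
    finally show ?case .
  qed
  have e0: "e s = 0" if "0 < s" "s < T" for s
  proof (rule ccontr)
    assume ne: "e s \<noteq> 0"
    obtain n where "C / \<bar>e s\<bar> < 2 ^ n"
      using real_arch_pow[of 2 "C / \<bar>e s\<bar>"] by auto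
    then show False
      using e_pow[OF that, of n] ne by (simp add: field_simps)
  qed
  have "e t = 0"
  proof (cases t T rule: linorder_cases)
    case greater
    then show ?thesis
      using e_add[of "t - T" T] e0[of "t - T"] eT t T by simp
  qed (use e0 eT t in auto)
  then show ?thesis
    by (simp add: e_def)
qed

text \<open>
  A great circle through the edge splits a lune into two lunes, one of which a rotation brings back to
  the standard position. The volume is thus additive and bounded in the angle, hence linear, and the
  right-angled lune, which is a quarter of the ball, fixes the factor.
\<close>

lemma ball_volume_lune:
  fixes e f :: "real^3"
  assumes ef: "e \<bullet> e = 1" "f \<bullet> f = 1" "e \<bullet> f = 0" and t: "0 < t" "t < pi"
  shows "ball_volume (open_half e \<inter> open_half (- circle_point e f t)) = 2 / 3 * t"
proof -
  let ?h = "circle_point e f"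
  define G where "G t = ball_volume (open_half e \<inter> open_half (- ?h t))" for t
  have h0: "?h 0 = e"
    by (simp add: circle_point_def)
  have hpi: "?h (t + pi) = - ?h t" for t
    by (simp add: circle_point_def)
  have ne: "?h t \<noteq> 0" for t
  proof
    assume "?h t = 0"
    then have "?h t \<bullet> ?h t = 0"
      by simp
    moreover have "?h t \<bullet> ?h t = (cos t)^2 + (sin t)^2"
      using ef by (simp add: circle_point_def algebra_simps inner_commute[of f e] power2_eq_square)
    ultimately show False
      by simp
  qed
  have rot: "ball_volume (open_half (?h (r + a)) \<inter> open_half (?h (s + a))) = ball_volume (open_half (?h r) \<inter> open_half (?h s))"
    for r s a
  proof -
    obtain R where "orthogonal_transformation R" "\<And>t. R (?h t) = ?h (t + a)"
      using rotation_in_plane_exists[OF ef, of a] by blast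
    then show ?thesis
      using ball_volume_wedge_image[of R "?h r" "?h s"] by simp
  qed
  have rot': "ball_volume (open_half (?h a) \<inter> open_half (- ?h (a + s))) = G s" for a s
  proof -
    have "?h (s + pi + a) = - ?h (a + s)"
      using hpi[of "a + s"] by (simp add: ac_simps)
    then show ?thesis
      using rot[of 0 a "s + pi"] by (simp add: G_def h0 hpi)
  qed
  have add: "G (r + s) = G r + G s" if rs: "0 < r" "0 < s" "r + s < pi" for r s
  proof -
    \<comment> \<open>For \<open>r + s < \<pi>\<close> the middle normal is a positive combination of the outer two, so it separates the two parts.\<close>
    have rel: "sin (r + s) * (?h r \<bullet> x) = sin s * (e \<bullet> x) + sin r * (?h (r + s) \<bullet> x)" for x
    proof -
      have "sin (r + s) *\<^sub>R ?h r = sin s *\<^sub>R e + sin r *\<^sub>R ?h (r + s)"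
      proof -
        have "sin (r + s) * cos r = sin s + sin r * cos (r + s)"
          using sin_diff[of "r + s" r] by (simp add: mult.commute)
        then show ?thesis
          by (simp add: circle_point_def algebra_simps flip: scaleR_add_left)
      qed
      then have "(sin (r + s) *\<^sub>R ?h r) \<bullet> x = (sin s *\<^sub>R e + sin r *\<^sub>R ?h (r + s)) \<bullet> x"
        by simp
      then show ?thesis
        by (simp add: inner_add_left)
    qed
    have pos: "0 < sin r" "0 < sin s" "0 < sin (r + s)"
      using rs by (simp_all add: sin_gt_zero)
    let ?S = "open_half e \<inter> open_half (- ?h (r + s))"
    have "?S \<inter> open_half (- ?h r) = open_half e \<inter> open_half (- ?h r)"
    proof -
      have "?h (r + s) \<bullet> x < 0" if "0 < e \<bullet> x" "?h r \<bullet> x < 0" for x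
      proof (rule ccontr)
        assume "\<not> ?h (r + s) \<bullet> x < 0"
        then have "0 \<le> sin r * (?h (r + s) \<bullet> x)" "0 < sin s * (e \<bullet> x)" "sin (r + s) * (?h r \<bullet> x) < 0"
          using pos that by (auto simp: mult_pos_neg)
        then show False
          using rel[of x] by linarith
      qed
      then show ?thesis
        by (auto simp: open_half_def)
    qed
    moreover have "?S \<inter> open_half (?h r) = open_half (?h r) \<inter> open_half (- ?h (r + s))"
    proof -
      have "0 < e \<bullet> x" if "0 < ?h r \<bullet> x" "?h (r + s) \<bullet> x < 0" for x
      proof (rule ccontr)
        assume "\<not> 0 < e \<bullet> x"
        then have "sin s * (e \<bullet> x) \<le> 0" "sin r * (?h (r + s) \<bullet> x) < 0" "0 < sin (r + s) * (?h r \<bullet> x)"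
          using pos that by (auto simp: mult_pos_neg mult_nonneg_nonpos)
        then show False
          using rel[of x] by linarith
      qed
      then show ?thesis
        by (auto simp: open_half_def)
    qed
    ultimately show ?thesis
      using ball_volume_split[of ?S "?h r"] ne by (simp add: rot') (simp add: G_def open_Int)
  qed
  have "G (pi / 2) = pi / 3"
  proof -
    have "ball_volume (open_half e \<inter> open_half (?h (pi/2))) = ball_volume (open_half (?h (pi/2)) \<inter> open_half (- ?h (pi / 2 + pi / 2)))"
      using hpi[of 0] by (simp add: h0 Int_commute)
    also have "\<dots> = G (pi / 2)"
      by (rule rot')
    finally show ?thesis
      using ball_volume_split[of "open_half e" "?h (pi/2)"] ne[of "pi/2"] ne[of 0] ball_volume_half[of e]
      by (simp add: G_def h0)
  qed
  moreover have "\<bar>G s\<bar> \<le> 4 * pi / 3" for s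
    using ball_volume_nonneg ball_volume_le[of "open_half e \<inter> open_half (- ?h s)"] by (simp add: G_def open_Int)
  then have "G t = G (pi / 2) / (pi / 2) * t"
    using additive_bounded_linear[of "pi / 2" G "4 * pi / 3" t] add t by simp
  ultimately have "G t = (pi / 3) / (pi / 2) * t"
    by (simp only:)
  then show ?thesis
    by (simp add: G_def)
qed

text \<open>
  The dihedral angle of a wedge is \<open>\<pi>\<close> minus the angle between its inner normals, which explains the minus sign.
\<close>

lemma ball_volume_wedge:
  fixes m n :: "real^3"
  assumes mn: "cross3 m n \<noteq> 0"
  shows "ball_volume (open_half m \<inter> open_half n) = 2 / 3 * arccos (- (m \<bullet> n) / (norm m * norm n))"
proof -
  have nz: "m \<noteq> 0" "n \<noteq> 0"
    using mn by auto
  define e where "e = m /\<^sub>R norm m"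
  define k where "k = n /\<^sub>R norm n"
  define c where "c = e \<bullet> k"
  have ee: "e \<bullet> e = 1" and kk: "k \<bullet> k = 1"
    using nz by (simp_all add: e_def k_def dot_square_norm power2_eq_square)
  have c: "c = (m \<bullet> n) / (norm m * norm n)"
    by (simp add: c_def e_def k_def divide_inverse mult_ac)
  have "cross3 e k \<noteq> 0"
    using mn nz by (simp add: e_def k_def cross_mult_left cross_mult_right)
  then have "0 < (norm (cross3 e k))^2"
    by simp
  moreover have "(norm (cross3 e k))^2 + c^2 = 1"
    using norm_cross_dot[of e k] ee kk by (simp add: c_def norm_eq_sqrt_inner)
  ultimately have c1: "c^2 < 1"
    by linarith
  then have cb: "-1 < c" "c < 1"
    by (auto simp: abs_square_less_1)
  define t where "t = arccos (- c)"
  have ct: "cos t = - c"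
    using cb by (simp add: t_def)
  have t: "0 < t" "t < pi"
    using arccos_lt_bounded[of "-c"] cb by (simp_all add: t_def)
  then have st: "0 < sin t"
    by (simp add: sin_gt_zero)
  have st2: "(sin t)^2 = 1 - c^2"
    using sin_squared_eq[of t] ct by simp
  \<comment> \<open>Gram-Schmidt, oriented such that the second normal is \<open>- circle_point e f t\<close> for the dihedral angle \<open>t\<close>.\<close>
  define f where "f = (c *\<^sub>R e - k) /\<^sub>R sin t"
  have ef: "e \<bullet> f = 0"
    using ee by (simp add: f_def inner_diff_right c_def)
  have "(c *\<^sub>R e - k) \<bullet> (c *\<^sub>R e - k) = 1 - c^2"
    using ee kk by (simp add: algebra_simps inner_commute[of k e] c_def power2_eq_square)
  then have ff: "f \<bullet> f = 1"
    using st unfolding f_def inner_scaleR_left inner_scaleR_right st2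
    by (simp add: field_simps flip: st2) (simp add: power2_eq_square)
  have "circle_point e f t = - k"
    using st ct by (simp add: circle_point_def f_def)
  then have "ball_volume (open_half e \<inter> open_half k) = 2 / 3 * t"
    using ball_volume_lune[OF ee ff ef t] by simp
  then show ?thesis
    using nz by (simp add: e_def k_def open_half_pos_scaleR t_def c)
qed

section \<open>The area of a spherical triangle\<close>

text \<open>
  Girard's theorem. The three planes cut the ball into eight cones, equal in antipodal pairs. The three
  wedges cover the cone three times and each of its three neighbours once, and the cone together with
  isometric copies of these neighbours fills half the ball.
\<close>

lemma girard:
  fixes a b c :: "real^3"
  assumes D: "a \<bullet> cross3 b c \<noteq> 0"
  shows "ball_volume (open_half a \<inter> open_half b \<inter> open_half c) =
    (arccos (- (b \<bullet> c) / (norm b * norm c)) + arccos (- (c \<bullet> a) / (norm c * norm a))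
      + arccos (- (a \<bullet> b) / (norm a * norm b)) - pi) / 3"
proof -
  have cr: "cross3 b c \<noteq> 0" "cross3 c a \<noteq> 0" "cross3 a b \<noteq> 0"
    using D cross_triple[of a b c] cross_triple[of b c a] by (auto simp: inner_commute)
  then have nz: "a \<noteq> 0" "b \<noteq> 0" "c \<noteq> 0"
    by auto
  define T where "T x y z = ball_volume (open_half x \<inter> open_half y \<inter> open_half z)" for x y z
  have split: "ball_volume (open_half y \<inter> open_half z) = T x y z + T (- x) y z" if "x \<noteq> 0" for x y z
    using ball_volume_split[of "open_half y \<inter> open_half z" x] that
    by (simp add: T_def Int_commute Int_left_commute open_Int)
  have perm: "T x y z = T y x z" "T x y z = T x z y" for x y z
    by (simp_all add: T_def Int_commute Int_left_commute)
  have antipodal: "T (- x) (- y) (- z) = T x y z" for x y z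
  proof -
    have neg: "orthogonal_transformation (uminus :: real^3 \<Rightarrow> _)"
      using orthogonal_transformation_neg[of "\<lambda>x::real^3. x"] by simp
    have "uminus ` (open_half x \<inter> open_half y \<inter> open_half z)
        = open_half (- x) \<inter> open_half (- y) \<inter> open_half (- z)"
      by (simp add: image_Int inj_def image_open_half[OF neg])
    then show ?thesis
      using ball_volume_orthogonal_image[OF neg, of "open_half x \<inter> open_half y \<inter> open_half z"]
      by (simp add: T_def open_Int)
  qed
  have "2 * pi / 3 = ball_volume (open_half b \<inter> open_half a) + ball_volume (open_half (- b) \<inter> open_half a)"
    using ball_volume_split[of "open_half a" b] ball_volume_half[of a] nz by (simp add: Int_commute)
  also have "\<dots> = T c b a + T (- c) b a + (T c (- b) a + T (- c) (- b) a)"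
    using split[of c b a] split[of c "- b" a] nz by simp
  also have "T (- c) (- b) a = T (- a) b c"
    using antipodal[of c b "- a"] perm(1)[of c b] perm(2)[of b c] perm(1)[of b "- a"] by simp
  finally have half: "2 * pi / 3 = T a b c + T (- c) a b + T (- b) a c + T (- a) b c"
    using perm by (metis add.assoc)
  have "2 / 3 * arccos (- (b \<bullet> c) / (norm b * norm c)) = T a b c + T (- a) b c"
    using ball_volume_wedge[OF cr(1)] split[of a b c] nz by simp
  moreover have "2 / 3 * arccos (- (c \<bullet> a) / (norm c * norm a)) = T a b c + T (- b) a c"
    using ball_volume_wedge[OF cr(2)] split[of b a c] nz perm by (metis Int_commute)
  moreover have "2 / 3 * arccos (- (a \<bullet> b) / (norm a * norm b)) = T a b c + T (- c) a b"
    using ball_volume_wedge[OF cr(3)] split[of c a b] nz perm by metis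
  ultimately show ?thesis
    using half unfolding T_def by argo
qed

lemma cis_arccos:
  assumes "0 < y"
  shows "cis (arccos (x / cmod (Complex x y))) = Complex x y / of_real (cmod (Complex x y))"
proof -
  let ?r = "cmod (Complex x y)"
  have r2: "?r^2 = x^2 + y^2"
    by (simp add: cmod_power2)
  have r: "0 < ?r"
    using assms by (simp add: complex_eq_iff)
  have "\<bar>x\<bar> \<le> ?r"
    using abs_Re_le_cmod[of "Complex x y"] by simp
  then have b: "- 1 \<le> x / ?r" "x / ?r \<le> 1"
    using r by (auto simp: field_simps abs_le_iff)
  have "sin (arccos (x / ?r)) = sqrt (1 - (x / ?r)^2)"
    using b by (rule sin_arccos)
  also have "1 - (x / ?r)^2 = (y / ?r)^2"
  proof -
    have "?r^2 \<noteq> 0"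
      using r by simp
    then have "1 - x^2 / ?r^2 = (?r^2 - x^2) / ?r^2"
      by (simp add: diff_divide_distrib)
    then show ?thesis
      using r2 by (simp add: power_divide)
  qed
  finally have "sin (arccos (x / ?r)) = y / ?r"
    using r assms by simp
  then show ?thesis
    using b by (simp add: complex_eq_iff Re_divide_of_real Im_divide_of_real)
qed

lemma inner_cross_cross:
  "cross3 a b \<bullet> cross3 c d = (a \<bullet> c) * (b \<bullet> d) - (a \<bullet> d) * (b \<bullet> c)"
  by (simp add: cross3_simps)

lemma gram_det_unit:
  fixes u v w :: "real^3"
  assumes "u \<bullet> u = 1" "v \<bullet> v = 1" "w \<bullet> w = 1"
  shows "(u \<bullet> cross3 v w)^2 = 1 + 2 * (v \<bullet> w) * (w \<bullet> u) * (u \<bullet> v) - (v \<bullet> w)^2 - (w \<bullet> u)^2 - (u \<bullet> v)^2"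
proof -
  have "cross3 (cross3 w u) (cross3 u v) = (u \<bullet> cross3 v w) *\<^sub>R u"
    unfolding cross_cross_det
    using cross_triple[of u v w] by (simp add: dot_cross_det[symmetric] dot_cross_self inner_commute)
  then have "(norm (cross3 (cross3 w u) (cross3 u v)))^2 = (u \<bullet> cross3 v w)^2"
    using assms by (simp only: power2_norm_eq_inner) (simp add: power2_eq_square)
  then show ?thesis
    using norm_cross_dot[of "cross3 w u" "cross3 u v"] assms
    by (simp add: power_mult_distrib power2_norm_eq_inner inner_cross_cross inner_commute[of u w]
        inner_commute[of w v] inner_commute[of v u])
      (simp add: algebra_simps power2_eq_square)
qed

text \<open>
  Cramer's rule: for independent \<open>u\<close>, \<open>v\<close>, \<open>w\<close> the cross products are, up to the factor \<open>u \<bullet> (v \<times> w)\<close>,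
  the dual basis, so their signs decide membership in the cone over \<open>u\<close>, \<open>v\<close>, \<open>w\<close>.
\<close>

lemma triple_product_expansion:
  fixes u v w x :: "real^3"
  shows "(u \<bullet> cross3 v w) *\<^sub>R x
    = (cross3 v w \<bullet> x) *\<^sub>R u + (cross3 w u \<bullet> x) *\<^sub>R v + (cross3 u v \<bullet> x) *\<^sub>R w"
  by (simp add: cross3_simps forall_3)

lemma convex_cone_hull_insert:
  fixes a :: "'a::real_vector"
  shows "convex_cone hull (insert a S) = {c *\<^sub>R a + y | c y. 0 \<le> c \<and> y \<in> convex_cone hull S}"
proof -
  have "convex_cone hull {a} = {c *\<^sub>R a | c. 0 \<le> c}"
    by (auto simp: convex_cone_hull_separate_nonempty conic_hull_explicit)
  then show ?thesis
    using convex_cone_hull_Un[of "{a}" S] by auto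
qed

lemma convex_cone_hull_3:
  "convex_cone hull {u, v, w} = {b *\<^sub>R u + c *\<^sub>R v + d *\<^sub>R w | b c d. 0 \<le> b \<and> 0 \<le> c \<and> 0 \<le> d}"
  for u :: "'a::real_vector"
proof (intro set_eqI iffI)
  fix x
  assume "x \<in> convex_cone hull {u, v, w}"
  then obtain b c d where "x = b *\<^sub>R u + (c *\<^sub>R v + d *\<^sub>R w)" "0 \<le> b" "0 \<le> c" "0 \<le> d"
    by (auto simp: convex_cone_hull_insert)
  then show "x \<in> {b *\<^sub>R u + c *\<^sub>R v + d *\<^sub>R w | b c d. 0 \<le> b \<and> 0 \<le> c \<and> 0 \<le> d}"
    by (auto simp: add.assoc)
next
  fix x
  assume "x \<in> {b *\<^sub>R u + c *\<^sub>R v + d *\<^sub>R w | b c d. 0 \<le> b \<and> 0 \<le> c \<and> 0 \<le> d}"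
  then obtain b c d where "x = b *\<^sub>R u + c *\<^sub>R v + d *\<^sub>R w" "0 \<le> b" "0 \<le> c" "0 \<le> d"
    by blast
  then show "x \<in> convex_cone hull {u, v, w}"
    by (simp, intro convex_cone_hull_add convex_cone_hull_mul hull_inc) auto
qed

text \<open>
  A form of Girard's theorem in terms of the sides of the spherical triangle only, which suits edge
  lengths. Let \<open>D = u \<bullet> (v \<times> w)\<close>. The angles of the triangle are the arguments of
  \<open>p - q r + i D\<close>, \<open>q - r p + i D\<close> and \<open>r - p q + i D\<close>, and the product of these three numbers is a
  negative multiple of \<open>(1 + p + q + r + i D)\<^sup>2\<close>. So the angle sum minus \<open>\<pi>\<close> is twice the argument of
  \<open>1 + p + q + r + i D\<close> modulo \<open>2\<pi>\<close>, and the range of both sides makes them equal.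
\<close>

lemma ball_volume_cone_pos:
  fixes u v w :: "real^3"
  assumes unit: "u \<bullet> u = 1" "v \<bullet> v = 1" "w \<bullet> w = 1"
    and D: "0 < u \<bullet> cross3 v w"
    and pqr: "p = v \<bullet> w" "q = w \<bullet> u" "r = u \<bullet> v"
  shows "ball_volume (convex_cone hull {u, v, w}) =
    2 / 3 * arccos ((1 + p + q + r) / sqrt (2 * ((1 + p) * (1 + q) * (1 + r))))"
proof -
  define D where "D = u \<bullet> cross3 v w"
  have D0: "0 < D"
    using D by (simp add: D_def)
  have D2: "D^2 = 1 + 2 * p * q * r - p^2 - q^2 - r^2"
    using gram_det_unit[OF unit] by (simp add: D_def pqr)
  have com: "w \<bullet> v = p" "u \<bullet> w = q" "v \<bullet> u = r"
    by (simp_all add: pqr inner_commute)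
  note ips = unit pqr[symmetric] com
  have triple: "cross3 v w \<bullet> u = D" "cross3 w u \<bullet> v = D" "cross3 u v \<bullet> w = D"
    using cross_triple[of u v w] cross_triple[of v w u] by (simp_all add: D_def inner_commute)
  \<comment> \<open>Inner normals of the three faces of the cone.\<close>
  define a b c where "a = cross3 v w" and "b = cross3 w u" and "c = cross3 u v"
  note abc = a_def b_def c_def
  have sq: "(norm a)^2 = 1 - p^2" "(norm b)^2 = 1 - q^2" "(norm c)^2 = 1 - r^2"
    unfolding power2_norm_eq_inner abc inner_cross_cross by (simp_all add: ips power2_eq_square)
  have ip: "- (b \<bullet> c) = p - q * r" "- (c \<bullet> a) = q - r * p" "- (a \<bullet> b) = r - p * q"
    unfolding abc inner_cross_cross by (simp_all add: ips mult.commute)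
  have "cross3 b c = D *\<^sub>R u"
    unfolding abc cross_cross_det
    by (simp add: dot_cross_det[symmetric] dot_cross_self inner_commute[of w] triple)
  then have "a \<bullet> cross3 b c = D^2"
    using triple by (simp add: a_def power2_eq_square)
  then have abc0: "a \<bullet> cross3 b c \<noteq> 0"
    using D0 by simp
  let ?P = "Complex (p - q * r) D" and ?Q = "Complex (q - r * p) D" and ?R = "Complex (r - p * q) D"
  let ?Z = "Complex (1 + p + q + r) D"
  have cmodI: "cmod (Complex s D) = t" if "s^2 + D^2 = t^2" "0 \<le> t" for s t
    using that by (simp add: cmod_def)
  have nP: "norm b * norm c = cmod ?P"
    by (rule cmodI[symmetric]) (simp_all add: D2 power_mult_distrib sq, simp add: algebra_simps power2_eq_square)
  have nQ: "norm c * norm a = cmod ?Q"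
    by (rule cmodI[symmetric]) (simp_all add: D2 power_mult_distrib sq, simp add: algebra_simps power2_eq_square)
  have nR: "norm a * norm b = cmod ?R"
    by (rule cmodI[symmetric]) (simp_all add: D2 power_mult_distrib sq, simp add: algebra_simps power2_eq_square)
  have nZ: "cmod ?Z = sqrt (2 * ((1 + p) * (1 + q) * (1 + r)))"
    unfolding cmod_def by (simp add: D2, simp add: algebra_simps power2_eq_square)
  define \<alpha> \<beta> \<gamma> where "\<alpha> = arccos ((p - q * r) / cmod ?P)" and "\<beta> = arccos ((q - r * p) / cmod ?Q)"
    and "\<gamma> = arccos ((r - p * q) / cmod ?R)"
  define \<phi> where "\<phi> = arccos ((1 + p + q + r) / cmod ?Z)"
  define K where "K = (1 - p) * (1 - q) * (1 - r) / 2"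
  define V where "V = ball_volume (open_half a \<inter> open_half b \<inter> open_half c)"
  have gir: "3 * V = \<alpha> + \<beta> + \<gamma> - pi"
    unfolding V_def using girard[OF abc0] by (simp add: ip nP nQ nR \<alpha>_def \<beta>_def \<gamma>_def)
  have K0: "0 \<le> K"
  proof -
    have "p \<le> 1" "q \<le> 1" "r \<le> 1"
      using norm_cauchy_schwarz[of v w] norm_cauchy_schwarz[of w u] norm_cauchy_schwarz[of u v] unit
      by (simp_all add: pqr norm_eq_sqrt_inner)
    then show ?thesis
      by (simp add: K_def)
  qed
  have prod: "?P * ?Q * ?R = - (of_real K * (?Z)^2)"
  proof -
    have "(p - q * r) * (q - r * p) * (r - p * q) - D^2 * ((p - q * r) + (q - r * p) + (r - p * q))
        = - K * ((1 + p + q + r)^2 - D^2)"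
      unfolding D2 K_def by (simp add: field_simps power2_eq_square)
    moreover have "(p - q * r) * (q - r * p) + (q - r * p) * (r - p * q) + (r - p * q) * (p - q * r) - D^2
        = - 2 * K * (1 + p + q + r)"
      unfolding D2 K_def by (simp add: field_simps power2_eq_square)
    then have "D * ((p - q * r) * (q - r * p) + (q - r * p) * (r - p * q) + (r - p * q) * (p - q * r) - D^2)
        = D * (- 2 * K * (1 + p + q + r))"
      by simp
    ultimately show ?thesis
      by (simp add: complex_eq_iff power2_eq_square algebra_simps)
  qed
  then have "cmod (?P * ?Q * ?R) = cmod (of_real K * (?Z)^2)"
    by (simp only: norm_minus_cancel)
  then have nprod: "cmod ?P * cmod ?Q * cmod ?R = K * (cmod ?Z)^2"
    using K0 by (simp add: norm_mult norm_power)
  have nz: "cmod ?P \<noteq> 0" "cmod ?Q \<noteq> 0" "cmod ?R \<noteq> 0" "cmod ?Z \<noteq> 0"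
    using D0 by (simp_all add: complex_eq_iff)
  then have K1: "K \<noteq> 0"
    using nprod by force
  have "cis (\<alpha> + \<beta> + \<gamma>) = (?P * ?Q * ?R) / of_real (cmod ?P * cmod ?Q * cmod ?R)"
    using D0 by (simp add: \<alpha>_def \<beta>_def \<gamma>_def cis_arccos flip: cis_mult)
  also have "\<dots> = - ((?Z / of_real (cmod ?Z))^2)"
    unfolding prod nprod using K1 by (simp add: power_divide)
  also have "\<dots> = cis (2 * \<phi> + pi)"
    using D0 by (simp add: \<phi>_def cis_arccos[symmetric] power2_eq_square cis_mult flip: cis_mult[of _ pi])
  finally have "cis (\<alpha> + \<beta> + \<gamma>) / cis (2 * \<phi> + pi) = 1"
    by simp
  then have "cis (3 * V - 2 * \<phi>) = 1"
    by (simp add: cis_divide gir diff_diff_eq add.commute)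
  from arg_cong[OF this, of Re] have "cos (3 * V - 2 * \<phi>) = 1"
    by simp
  then obtain k :: int where "3 * V - 2 * \<phi> = of_int k * 2 * pi"
    unfolding cos_one_2pi_int by blast
  then have k: "3 * V - 2 * \<phi> = of_int k * (2 * pi)"
    by simp
  have rng: "0 < arccos (s / cmod (Complex s D)) \<and> arccos (s / cmod (Complex s D)) < pi" for s
  proof -
    have "s^2 < (cmod (Complex s D))^2"
      using D0 by (simp add: cmod_power2)
    then have "\<bar>s\<bar> < cmod (Complex s D)"
      by (simp add: abs_square_less_1 power2_less_imp_less)
    moreover have "0 < cmod (Complex s D)"
      using D0 by (simp add: complex_eq_iff)
    ultimately have "- 1 < s / cmod (Complex s D)" "s / cmod (Complex s D) < 1"
      by (auto simp: pos_less_divide_eq pos_divide_less_eq abs_less_iff)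
    then show ?thesis
      using arccos_lt_bounded by blast
  qed
  have "\<alpha> < pi" "\<beta> < pi" "\<gamma> < pi" "0 < \<phi>" "\<phi> < pi"
    using rng unfolding \<alpha>_def \<beta>_def \<gamma>_def \<phi>_def by blast+
  then have "\<bar>3 * V - 2 * \<phi>\<bar> < 1 * (2 * pi)"
    using gir ball_volume_nonneg[of "open_half a \<inter> open_half b \<inter> open_half c"] unfolding V_def by linarith
  then have "\<bar>of_int k\<bar> < (1::real)"
    unfolding k abs_mult using mult_less_cancel_right_pos[of "2 * pi"] by simp
  then have "k = 0"
    by linarith
  then have V: "V = 2 / 3 * \<phi>"
    using k by simp
  let ?C = "convex_cone hull {u, v, w}" and ?O = "open_half a \<inter> open_half b \<inter> open_half c"
  have C: "?C = {x. 0 \<le> a \<bullet> x \<and> 0 \<le> b \<bullet> x \<and> 0 \<le> c \<bullet> x}" (is "_ = ?C'")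
  proof
    have *: "a \<bullet> v = 0" "a \<bullet> w = 0" "b \<bullet> u = 0" "b \<bullet> w = 0" "c \<bullet> u = 0" "c \<bullet> v = 0"
      by (simp_all add: abc dot_cross_self)
    show "?C \<subseteq> ?C'"
      using D0 triple * by (auto simp: convex_cone_hull_3 inner_add_right abc[symmetric])
    show "?C' \<subseteq> ?C"
    proof
      fix x
      assume x: "x \<in> ?C'"
      have "D *\<^sub>R x = (a \<bullet> x) *\<^sub>R u + (b \<bullet> x) *\<^sub>R v + (c \<bullet> x) *\<^sub>R w"
        unfolding D_def abc by (rule triple_product_expansion)
      then have "x = (1 / D) *\<^sub>R ((a \<bullet> x) *\<^sub>R u + (b \<bullet> x) *\<^sub>R v + (c \<bullet> x) *\<^sub>R w)"
        using D0 by (metis less_irrefl nonzero_divide_eq_eq scaleR_one scaleR_scaleR)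
      also have "\<dots> \<in> ?C"
        using x D0 by (intro convex_cone_hull_mul convex_cone_hull_add) (auto intro: hull_inc)
      finally show "x \<in> ?C" .
    qed
  qed
  have nz: "a \<noteq> 0" "b \<noteq> 0" "c \<noteq> 0"
    using triple D0 by (auto simp: abc)
  then have "negligible ({x. a \<bullet> x = 0} \<union> {x. b \<bullet> x = 0} \<union> {x. c \<bullet> x = 0})"
    by (simp add: negligible_hyperplane)
  then have "negligible (?O - ?C \<union> (?C - ?O))"
    by (rule negligible_subset) (auto simp: C open_half_def)
  then have "ball_volume ?C = V"
    unfolding V_def by (intro ball_volume_negligible_diff) (auto simp: open_Int)
  then show ?thesis
    by (simp add: V \<phi>_def nZ)
qed

lemma ball_volume_cone:
  fixes u v w :: "real^3"
  assumes unit: "u \<bullet> u = 1" "v \<bullet> v = 1" "w \<bullet> w = 1"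
    and D: "u \<bullet> cross3 v w \<noteq> 0"
    and pqr: "p = v \<bullet> w" "q = w \<bullet> u" "r = u \<bullet> v"
  shows "ball_volume (convex_cone hull {u, v, w}) =
    2 / 3 * arccos ((1 + p + q + r) / sqrt (2 * ((1 + p) * (1 + q) * (1 + r))))"
proof (cases "0 < u \<bullet> cross3 v w")
  case True
  then show ?thesis
    using ball_volume_cone_pos[OF unit] pqr by blast
next
  case False
  then have "0 < u \<bullet> cross3 w v"
    using D cross_skew[of v w] by simp
  then show ?thesis
    using ball_volume_cone_pos[OF unit(1,3,2), of p r q] pqr
    by (simp add: inner_commute insert_commute add_ac mult_ac)
qed

section \<open>Frames, geodesics and the law of cosines\<close>

fun gsin :: "geometry \<Rightarrow> real \<Rightarrow> real" where
  "gsin Spherical t = sin t"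
| "gsin Hyperbolic t = sinh t"
| "gsin Euclidean t = t"

fun gcos :: "geometry \<Rightarrow> real \<Rightarrow> real" where
  "gcos Spherical t = cos t"
| "gcos Hyperbolic t = cosh t"
| "gcos Euclidean t = 1"

lemma geodesic_eq: "geodesic g p v t = gcos g t *\<^sub>R p + gsin g t *\<^sub>R v"
  by (cases g) simp_all

lemma form_add_left: "form g (u + v) w = form g u w + form g v w"
  and form_scaleR_left: "form g (c *\<^sub>R u) w = c * form g u w"
  and form_add_right: "form g w (u + v) = form g w u + form g w v"
  and form_scaleR_right: "form g w (c *\<^sub>R u) = c * form g w u"
  and form_commute: "form g u v = form g v u"
  by (cases g; simp add: inner_add_left inner_add_right inner_commute algebra_simps)+

lemmas form_simps = form_add_left form_scaleR_left form_add_right form_scaleR_right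

lemma form_Hyperbolic_inner: "form Hyperbolic u v = u \<bullet> v - 2 * (u $ 1) * (v $ 1)"
  by (simp add: inner_vec_def sum_4)

lemma gdist_commute: "gdist g p q = gdist g q p"
  by (cases g) (simp_all add: inner_commute dist_commute mult.commute)

lemma hyperplane_frame_exists:
  fixes n :: "real^4"
  assumes "n \<noteq> 0"
  obtains \<phi> :: "real^3 \<Rightarrow> real^4"
  where "linear \<phi>" "range \<phi> = {v. n \<bullet> v = 0}" "\<And>u v. \<phi> u \<bullet> \<phi> v = u \<bullet> v"
proof -
  have "dim (UNIV :: (real^3) set) = dim {v. n \<bullet> v = 0}"
    using assms by (simp add: dim_hyperplane)
  then obtain \<phi> :: "real^3 \<Rightarrow> real^4" where \<phi>: "linear \<phi>" "range \<phi> = {v. n \<bullet> v = 0}"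
    "\<And>x. norm (\<phi> x) = norm x"
    using isometry_subspaces[of "UNIV :: (real^3) set" "{v. n \<bullet> v = 0}"]
    by (metis UNIV_I subspace_UNIV subspace_hyperplane)
  have "\<phi> u \<bullet> \<phi> v = u \<bullet> v" for u v
    unfolding dot_norm using \<phi> by (simp flip: linear_add)
  with \<phi> show ?thesis
    using that by blast
qed

text \<open>
  On the hyperboloid a frame arises by transporting a Euclidean frame at the apex \<open>axis 1 1\<close> with the
  Lorentz boost that takes the apex to \<open>p\<close>.
\<close>

lemma tangent_frame_exists:
  assumes p: "p \<in> points g"
  shows "\<exists>\<phi>. tangent_frame g p \<phi>"
proof -
  have e1: "axis 1 1 \<bullet> v = v $ 1" for v :: "real^4"
    by (simp add: inner_axis')
  show ?thesis
  proof (cases g)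
    case Spherical
    with p have "p \<noteq> 0"
      by auto
    then obtain \<phi> :: "real^3 \<Rightarrow> real^4" where "linear \<phi>" "range \<phi> = {v. p \<bullet> v = 0}" "\<And>u v. \<phi> u \<bullet> \<phi> v = u \<bullet> v"
      using hyperplane_frame_exists by blast
    then show ?thesis
      using Spherical by (auto simp: tangent_frame_def)
  next
    case Euclidean
    have "axis 1 1 \<noteq> (0 :: real^4)"
      by (simp add: axis_eq_0_iff)
    then obtain \<phi> :: "real^3 \<Rightarrow> real^4" where "linear \<phi>" "range \<phi> = {v. axis 1 1 \<bullet> v = 0}" "\<And>u v. \<phi> u \<bullet> \<phi> v = u \<bullet> v"
      using hyperplane_frame_exists by blast
    then show ?thesis
      using Euclidean by (auto simp: tangent_frame_def e1)
  next
    case Hyperbolic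
    have "axis 1 1 \<noteq> (0 :: real^4)"
      by (simp add: axis_eq_0_iff)
    then obtain \<psi> :: "real^3 \<Rightarrow> real^4" where \<psi>: "linear \<psi>" "range \<psi> = {v. axis 1 1 \<bullet> v = 0}" "\<And>u v. \<psi> u \<bullet> \<psi> v = u \<bullet> v"
      using hyperplane_frame_exists by blast
    have \<psi>1: "\<psi> u $ 1 = 0" for u
      using \<psi>(2) e1 by (metis (mono_tags, lifting) mem_Collect_eq rangeI)
    have pp: "form Hyperbolic p p = - 1" and p1: "0 < p $ 1"
      using p Hyperbolic by auto
    define c where "c = p + axis 1 1"
    \<comment> \<open>The restriction of the boost from \<open>axis 1 1\<close> to \<open>p\<close> to the vectors \<open>v\<close> with \<open>v $ 1 = 0\<close>.\<close>
    define boost where "boost v = v + ((p \<bullet> v) / (1 + p $ 1)) *\<^sub>R c" for v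
    have fc: "form Hyperbolic v (axis 1 1) = - v $ 1" for v :: "real^4"
      by (simp add: axis_def)
    have fpv: "form Hyperbolic p v = p \<bullet> v" if "v $ 1 = 0" for v
      unfolding form_Hyperbolic_inner using that by simp
    have pc: "form Hyperbolic p c = - (1 + p $ 1)" and cc: "form Hyperbolic c c = - 2 * (1 + p $ 1)"
      using pp fc[of p] fc[of "axis 1 1"] form_commute[of Hyperbolic "axis 1 1" p]
      by (simp_all only: c_def form_simps) (simp_all add: axis_def)
    have vc: "form Hyperbolic v c = p \<bullet> v" if "v $ 1 = 0" for v
      using that fpv[of v] fc[of v] form_commute[of Hyperbolic v p] by (simp only: c_def form_simps)
    have bform: "form Hyperbolic (boost v) (boost w) = v \<bullet> w" if "v $ 1 = 0" "w $ 1 = 0" for v w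
    proof -
      define a b where "a = (p \<bullet> v) / (1 + p $ 1)" and "b = (p \<bullet> w) / (1 + p $ 1)"
      have "form Hyperbolic (boost v) (boost w)
          = form Hyperbolic v w + b * (p \<bullet> v) + a * (p \<bullet> w) + a * b * form Hyperbolic c c"
        using vc[OF that(1)] vc[OF that(2)] form_commute[of Hyperbolic c w]
        unfolding boost_def form_simps a_def[symmetric] b_def[symmetric]
        by (simp del: form.simps add: algebra_simps)
      also have "\<dots> = form Hyperbolic v w"
      proof -
        have "p \<bullet> v = a * (1 + p $ 1)" "p \<bullet> w = b * (1 + p $ 1)"
          using p1 by (simp_all add: a_def b_def)
        then show ?thesis
          unfolding cc by (simp del: form.simps add: algebra_simps)
      qed
      finally show ?thesis
        unfolding form_Hyperbolic_inner using that by simp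
    qed
    have btan: "form Hyperbolic p (boost v) = 0" if "v $ 1 = 0" for v
      using p1 unfolding boost_def form_simps fpv[OF that] pc by (simp add: field_simps)
    have bsurj: "\<exists>v. v $ 1 = 0 \<and> boost v = w" if w: "form Hyperbolic p w = 0" for w
    proof -
      define v where "v = w + (- (w $ 1 / (1 + p $ 1))) *\<^sub>R c"
      have v1: "v $ 1 = 0"
        using p1 by (simp add: v_def c_def add.commute[of _ 1])
      have "form Hyperbolic p v = w $ 1"
        using p1 unfolding v_def form_simps w pc by (simp add: field_simps)
      then have "boost v = w"
        using fpv[OF v1] by (simp add: boost_def v_def)
      with v1 show ?thesis
        by blast
    qed
    have "linear (boost \<circ> \<psi>)"
      by (intro linear_compose[OF \<psi>(1)] linearI)
        (simp_all add: boost_def inner_add_right algebra_simps add_divide_distrib)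
    moreover have "range (boost \<circ> \<psi>) = tangent_space Hyperbolic p"
    proof -
      have "range \<psi> = {v. v $ 1 = 0}"
        using \<psi>(2) e1 by simp
      then have "range (boost \<circ> \<psi>) = boost ` {v. v $ 1 = 0}"
        by (metis image_comp)
      also have "\<dots> = {v. form Hyperbolic p v = 0}"
        using btan bsurj by (auto simp del: form.simps)
      finally show ?thesis
        by (simp del: form.simps)
    qed
    moreover have "form Hyperbolic ((boost \<circ> \<psi>) u) ((boost \<circ> \<psi>) v) = u \<bullet> v" for u v
      using bform \<psi>1 \<psi>(3) by (simp del: form.simps)
    ultimately show ?thesis
      unfolding tangent_frame_def Hyperbolic by blast
  qed
qed

lemma point_not_tangent:
  assumes "p \<in> points g"
  shows "p \<notin> tangent_space g p"
  using assms by (cases g) auto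

lemma tangent_decomposition_unique:
  assumes p: "p \<in> points g" and \<phi>: "tangent_frame g p \<phi>"
    and eq: "a *\<^sub>R p + \<phi> u = b *\<^sub>R p + \<phi> v"
  shows "a = b" "u = v"
proof -
  have lin: "linear \<phi>" and ran: "range \<phi> = tangent_space g p"
    and iso: "\<And>u v. form g (\<phi> u) (\<phi> v) = u \<bullet> v"
    using \<phi> by (auto simp: tangent_frame_def)
  have d: "(a - b) *\<^sub>R p = \<phi> (v - u)"
    using eq by (simp add: linear_diff[OF lin] algebra_simps)
  show ab: "a = b"
  proof (rule ccontr)
    assume "a \<noteq> b"
    then have "p = \<phi> ((1 / (a - b)) *\<^sub>R (v - u))"
      using d by (simp add: linear_cmul[OF lin] flip: d)
    then show False
      using point_not_tangent[OF p] ran by blast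
  qed
  have "\<phi> (v - u) = 0"
    using d ab by simp
  then have "(v - u) \<bullet> (v - u) = form g 0 0"
    using iso[of "v - u" "v - u"] by simp
  then show "u = v"
    by (cases g) auto
qed

text \<open>
  The reversed Cauchy-Schwarz inequality for timelike vectors, deduced from the ordinary one for their
  spacelike parts \<open>P\<close> and \<open>Q\<close>.
\<close>

lemma neg_form_Hyperbolic_ge_1:
  assumes "p \<in> points Hyperbolic" "q \<in> points Hyperbolic"
  shows "1 \<le> - form Hyperbolic p q"
proof -
  define P Q where "P = p - (p $ 1) *\<^sub>R axis 1 1" and "Q = q - (q $ 1) *\<^sub>R axis 1 1"
  have PQ: "P \<bullet> Q = form Hyperbolic p q + p $ 1 * q $ 1" "P \<bullet> P = form Hyperbolic p p + (p $ 1)^2"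
    "Q \<bullet> Q = form Hyperbolic q q + (q $ 1)^2"
    unfolding P_def Q_def form_Hyperbolic_inner
    by (simp_all add: inner_diff_left inner_diff_right inner_axis inner_axis' power2_eq_square)
  have pos: "0 < p $ 1" "0 < q $ 1" and n: "P \<bullet> P = (p $ 1)^2 - 1" "Q \<bullet> Q = (q $ 1)^2 - 1"
    using assms PQ by simp_all
  then have "1 \<le> (p $ 1)^2" "1 \<le> (q $ 1)^2"
    using inner_ge_zero[of P] inner_ge_zero[of Q] by simp_all
  then have "1 \<le> p $ 1" "1 \<le> q $ 1"
    using pos power2_le_imp_le[of 1 "p $ 1"] power2_le_imp_le[of 1 "q $ 1"] by simp_all
  then have ge: "0 \<le> p $ 1 * q $ 1 - 1"
    using mult_mono[of 1 "p $ 1" 1 "q $ 1"] by simp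
  have "(P \<bullet> Q)^2 \<le> ((p $ 1)^2 - 1) * ((q $ 1)^2 - 1)"
    using Cauchy_Schwarz_ineq[of P Q] n by simp
  also have "\<dots> = (p $ 1 * q $ 1 - 1)^2 - (p $ 1 - q $ 1)^2"
    by (simp add: algebra_simps power2_eq_square)
  also have "\<dots> \<le> (p $ 1 * q $ 1 - 1)^2"
    by simp
  finally have "P \<bullet> Q \<le> p $ 1 * q $ 1 - 1"
    using ge by (rule power2_le_imp_le)
  then show ?thesis
    using PQ by simp
qed

lemma cos_gdist_Spherical:
  assumes "p \<in> points Spherical" "q \<in> points Spherical"
  shows "cos (gdist Spherical p q) = p \<bullet> q"
proof -
  have "\<bar>p \<bullet> q\<bar> \<le> 1"
    using Cauchy_Schwarz_ineq2[of p q] assms by (simp add: norm_eq_sqrt_inner)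
  then show ?thesis
    by simp
qed

lemma cosh_gdist_Hyperbolic:
  assumes "p \<in> points Hyperbolic" "q \<in> points Hyperbolic"
  shows "cosh (gdist Hyperbolic p q) = - form Hyperbolic p q"
  using neg_form_Hyperbolic_ge_1[OF assms] by (simp del: form.simps)

text \<open>
  Normal coordinates around \<open>p\<close>. The assumption \<open>q \<notin> span {p}\<close> excludes \<open>q = p\<close> and, on the sphere, the
  antipode, where the direction is not unique.
\<close>

lemma point_eq_geodesic:
  assumes p: "p \<in> points g" and q: "q \<in> points g" and ne: "q \<notin> span {p}"
    and \<phi>: "tangent_frame g p \<phi>"
  obtains u where "u \<bullet> u = 1" "q = geodesic g p (\<phi> u) (gdist g p q)" "0 < gsin g (gdist g p q)"
proof -
  have lin: "linear \<phi>" and ran: "range \<phi> = tangent_space g p"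
    and iso: "\<And>u v. form g (\<phi> u) (\<phi> v) = u \<bullet> v"
    using \<phi> by (auto simp: tangent_frame_def)
  let ?x = "gdist g p q"
  \<comment> \<open>The component of \<open>q\<close> tangent at \<open>p\<close>.\<close>
  define w where "w = q + (- gcos g ?x) *\<^sub>R p"
  have "w \<in> tangent_space g p \<and> form g w w = (gsin g ?x)^2 \<and> 0 \<le> gsin g ?x"
  proof (cases g)
    case Spherical
    have x: "cos ?x = p \<bullet> q"
      using cos_gdist_Spherical[of p q] p q Spherical by simp
    have "\<bar>p \<bullet> q\<bar> \<le> 1"
      using Cauchy_Schwarz_ineq2[of p q] p q Spherical by (simp add: norm_eq_sqrt_inner)
    then have "0 \<le> sin ?x"
      using arccos_lbound[of "p \<bullet> q"] arccos_ubound[of "p \<bullet> q"] Spherical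
      by (intro sin_ge_zero) auto
    moreover have "w \<bullet> w = 1 - (cos ?x)^2" "p \<bullet> w = 0"
      using p q unfolding w_def Spherical gcos.simps x[unfolded Spherical]
      by (simp_all add: inner_diff_left inner_diff_right inner_commute[of q p] power2_eq_square)
    ultimately show ?thesis
      using Spherical by (simp add: sin_squared_eq)
  next
    case Hyperbolic
    have x: "cosh ?x = - form Hyperbolic p q"
      using cosh_gdist_Hyperbolic[of p q] p q Hyperbolic by simp
    have "0 \<le> ?x"
      using neg_form_Hyperbolic_ge_1[of p q] p q Hyperbolic by (simp del: form.simps)
    moreover have "form Hyperbolic w w = (cosh ?x)^2 - 1" "form Hyperbolic p w = 0"
      using p q Hyperbolic x form_commute[of Hyperbolic q p] unfolding w_def
      by (simp_all only: form_simps points.simps mem_Collect_eq gcos.simps) (simp_all add: power2_eq_square algebra_simps)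
    ultimately show ?thesis
      using Hyperbolic by (simp add: cosh_square_eq del: form.simps)
  next
    case Euclidean
    then show ?thesis
      using p q by (simp add: w_def dist_norm norm_minus_commute[of p q] power2_norm_eq_inner)
  qed
  moreover from this obtain y where y: "w = \<phi> y"
    using ran by blast
  ultimately have yy: "y \<bullet> y = (gsin g ?x)^2" and s0: "0 \<le> gsin g ?x"
    using iso by auto
  have "y \<noteq> 0"
  proof
    assume "y = 0"
    then have "q = gcos g ?x *\<^sub>R p"
      using y linear_0[OF lin] by (simp add: w_def)
    then show False
      using ne by (metis span_base span_scale singletonI)
  qed
  then have s: "0 < gsin g ?x"
    using yy s0 by (metis inner_eq_zero_iff less_eq_real_def zero_power2)
  define u where "u = (1 / gsin g ?x) *\<^sub>R y"
  have "u \<bullet> u = 1"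
    using yy s by (simp add: u_def power2_eq_square)
  moreover have "q = geodesic g p (\<phi> u) ?x"
  proof -
    have "gsin g ?x *\<^sub>R \<phi> u = w"
      using s by (simp add: y u_def linear_cmul[OF lin])
    then show ?thesis
      by (simp add: geodesic_eq w_def)
  qed
  ultimately show ?thesis
    using s that by blast
qed

text \<open>
  In a triangle with sides \<open>x\<close>, \<open>y\<close> and angle \<open>\<theta>\<close> opposite to \<open>z\<close>, this is
  \<open>(1 + cos \<theta>) * (gsin g x * gsin g y)\<close>. The factorised shape is the same in the three geometries, and the exchange of edge lengths
  only permutes its factors.
\<close>

definition half_angle_product :: "geometry \<Rightarrow> real \<Rightarrow> real \<Rightarrow> real \<Rightarrow> real" where
  "half_angle_product g x y z = 2 * gsin g ((x + y + z) / 2) * gsin g ((x + y - z) / 2)"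

lemma half_angle_product_Spherical: "half_angle_product Spherical x y z = cos z - cos (x + y)"
  using cos_diff_cos[of z "x + y"] by (simp add: half_angle_product_def add.commute)

lemma half_angle_product_Hyperbolic: "half_angle_product Hyperbolic x y z = cosh (x + y) - cosh z"
proof -
  define s t where st: "s = (x + y + z) / 2" "t = (x + y - z) / 2"
  have "x + y = s + t" "z = s - t"
    by (simp_all add: st field_simps)
  then show ?thesis
    by (simp add: half_angle_product_def cosh_add cosh_diff flip: st)
qed

lemma law_of_cosines:
  assumes p: "p \<in> points g" and q: "q \<in> points g" "r \<in> points g" and \<phi>: "tangent_frame g p \<phi>"
    and u: "u \<bullet> u = 1" "q = geodesic g p (\<phi> u) x" and v: "v \<bullet> v = 1" "r = geodesic g p (\<phi> v) y"
    and z: "gdist g q r = z"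
  shows "(1 + u \<bullet> v) * (gsin g x * gsin g y) = half_angle_product g x y z"
proof -
  have lin: "linear \<phi>" and ran: "range \<phi> = tangent_space g p"
    and iso: "\<And>u v. form g (\<phi> u) (\<phi> v) = u \<bullet> v"
    using \<phi> by (auto simp: tangent_frame_def)
  have tan: "\<phi> t \<in> tangent_space g p" for t
    using ran by blast
  show ?thesis
  proof (cases g)
    case Spherical
    have "cos z = p \<bullet> p * cos x * cos y + sin x * sin y * (u \<bullet> v)"
      using cos_gdist_Spherical[of q r] q z u v tan[of u] tan[of v] iso[of u v] Spherical
      by (simp add: inner_add_left inner_add_right inner_commute[of "\<phi> u" p] inner_commute[of "\<phi> v" p])
    then have "cos z = cos x * cos y + sin x * sin y * (u \<bullet> v)"
      using p Spherical by simp
    then have "cos z - cos (x + y) = (1 + u \<bullet> v) * (sin x * sin y)"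
      by (simp add: cos_add algebra_simps)
    then show ?thesis
      using half_angle_product_Spherical Spherical by simp
  next
    case Hyperbolic
    have "form Hyperbolic q r = form Hyperbolic p p * cosh x * cosh y + sinh x * sinh y * (u \<bullet> v)"
      using tan[of u] tan[of v] form_commute[of g p "\<phi> u"] form_commute[of g p "\<phi> v"] Hyperbolic
      unfolding u v geodesic_eq iso[symmetric]
      by (simp only: form_simps tangent_space.simps mem_Collect_eq gcos.simps gsin.simps) (simp add: algebra_simps)
    then have "cosh z = cosh x * cosh y - sinh x * sinh y * (u \<bullet> v)"
      using cosh_gdist_Hyperbolic[of q r] q z p Hyperbolic by simp
    then show ?thesis
      using Hyperbolic by (simp add: half_angle_product_Hyperbolic cosh_add algebra_simps)
  next
    case Euclidean
    have "q - r = x *\<^sub>R \<phi> u - y *\<^sub>R \<phi> v"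
      using u v Euclidean by simp
    then have "z^2 = (x *\<^sub>R \<phi> u - y *\<^sub>R \<phi> v) \<bullet> (x *\<^sub>R \<phi> u - y *\<^sub>R \<phi> v)"
      using z Euclidean by (simp add: dist_norm power2_norm_eq_inner flip: z)
    also have "\<dots> = x^2 + y^2 - 2 * x * y * (u \<bullet> v)"
      using iso[of u u] iso[of v v] iso[of u v] u v Euclidean
      by (simp add: inner_diff_left inner_diff_right inner_commute[of "\<phi> v" "\<phi> u"] power2_eq_square algebra_simps)
    finally show ?thesis
      using Euclidean by (simp add: half_angle_product_def field_simps power2_eq_square)
  qed
qed

section \<open>Solid angles of tetrahedra\<close>

lemma eventually_gsin_pos: "\<forall>\<^sub>F t in at_right 0. 0 < gsin g t"
proof -
  have "\<forall>\<^sub>F t in at_right 0. t \<in> {0<..<pi}"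
    by (rule eventually_at_right_real) simp
  then show ?thesis
    by eventually_elim (cases g; simp add: sin_gt_zero)
qed

lemma gcos_gsin_tendsto: "(gcos g \<longlongrightarrow> 1) (at_right 0)" "(gsin g \<longlongrightarrow> 0) (at_right 0)"
proof -
  have "(cos \<longlongrightarrow> cos (0::real)) (at_right 0)" "(cosh \<longlongrightarrow> cosh (0::real)) (at_right 0)"
    "(sin \<longlongrightarrow> sin (0::real)) (at_right 0)" "(sinh \<longlongrightarrow> sinh (0::real)) (at_right 0)"
    by (intro tendsto_intros)+
  then show "(gcos g \<longlongrightarrow> 1) (at_right 0)" "(gsin g \<longlongrightarrow> 0) (at_right 0)"
    by (cases g; simp add: gcos.simps[abs_def] gsin.simps[abs_def])+
qed

lemma eventually_geodesic_in_points:
  assumes p: "p \<in> points g" and v: "v \<in> unit_tangent_sphere g p"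
  shows "\<forall>\<^sub>F t in at_right 0. geodesic g p v t \<in> points g"
proof -
  have lim: "((\<lambda>t. geodesic g p v t $ 1) \<longlongrightarrow> p $ 1) (at_right 0)"
  proof -
    have "((\<lambda>t. gcos g t * p $ 1 + gsin g t * v $ 1) \<longlongrightarrow> 1 * p $ 1 + 0 * v $ 1) (at_right 0)"
      by (intro tendsto_intros gcos_gsin_tendsto)
    then show ?thesis
      by (simp add: geodesic_eq)
  qed
  show ?thesis
  proof (cases g)
    case Spherical
    have "geodesic g p v t \<bullet> geodesic g p v t = (cos t)^2 + (sin t)^2" for t
      using p v Spherical
      by (simp add: unit_tangent_sphere_def inner_add_left inner_add_right inner_commute[of v p] power2_eq_square)
    then show ?thesis
      using Spherical by simp
  next
    case Hyperbolic
    have "form Hyperbolic (geodesic g p v t) (geodesic g p v t) = - 1" for t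
    proof -
      have "form Hyperbolic p p = - 1" "form Hyperbolic v v = 1" "form Hyperbolic p v = 0"
        "form Hyperbolic v p = 0"
        using p v Hyperbolic form_commute[of Hyperbolic v p] by (simp_all add: unit_tangent_sphere_def)
      then have "form Hyperbolic (geodesic g p v t) (geodesic g p v t) = (sinh t)^2 - (cosh t)^2"
        unfolding Hyperbolic geodesic_eq by (simp only: form_simps gcos.simps gsin.simps) (simp add: power2_eq_square)
      then show ?thesis
        by (simp add: cosh_square_eq)
    qed
    moreover have "\<forall>\<^sub>F t in at_right 0. 0 < geodesic g p v t $ 1"
      using p Hyperbolic by (intro order_tendstoD(1)[OF lim]) simp
    ultimately show ?thesis
      using Hyperbolic by (simp del: form.simps geodesic.simps)
  next
    case Euclidean
    then show ?thesis
      using p v by (simp add: unit_tangent_sphere_def)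
  qed
qed

text \<open>
  A geodesic that leaves \<open>A\<close> in a direction \<open>n\<close> has, for small times, a positive coefficient at \<open>A\<close>.
  So it enters the tetrahedron exactly when its other coefficients are nonnegative, and modulo \<open>A\<close>
  these are positive multiples of the coefficients of \<open>n\<close> in \<open>u\<close>, \<open>v\<close>, \<open>w\<close>.
\<close>

lemma inward_directions_eq_cone:
  assumes A: "A \<in> points g" and \<phi>: "tangent_frame g A \<phi>"
    and B: "B = geodesic g A (\<phi> u) x" "0 < gsin g x"
    and C: "C = geodesic g A (\<phi> v) y" "0 < gsin g y"
    and D: "D = geodesic g A (\<phi> w) z" "0 < gsin g z"
  shows "\<phi> -` inward_directions g (region g A B C D) A = sphere 0 1 \<inter> convex_cone hull {u, v, w}"
proof -
  have lin: "linear \<phi>" and ran: "range \<phi> = tangent_space g A"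
    and iso: "\<And>u v. form g (\<phi> u) (\<phi> v) = u \<bullet> v"
    using \<phi> by (auto simp: tangent_frame_def)
  note l = linear_add[OF lin] linear_cmul[OF lin]
  have unit: "\<phi> n \<in> unit_tangent_sphere g A \<longleftrightarrow> n \<in> sphere 0 1" for n
    using ran by (auto simp: unit_tangent_sphere_def iso norm_eq_1)
  have "(\<forall>\<^sub>F t in at_right 0. geodesic g A (\<phi> n) t \<in> region g A B C D) \<longleftrightarrow> n \<in> convex_cone hull {u, v, w}"
    if n: "n \<in> sphere 0 1" for n
  proof
    assume "\<forall>\<^sub>F t in at_right 0. geodesic g A (\<phi> n) t \<in> region g A B C D"
    with eventually_gsin_pos[of g] have "\<forall>\<^sub>F t in at_right 0. 0 < gsin g t \<and> geodesic g A (\<phi> n) t \<in> region g A B C D"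
      by (rule eventually_conj)
    then obtain t where t: "0 < gsin g t" "geodesic g A (\<phi> n) t \<in> region g A B C D"
      using eventually_happens'[OF trivial_limit_at_right_real[of "0::real"]] by blast
    then have "geodesic g A (\<phi> n) t \<in> convex_cone hull (insert A {B, C, D})"
      by (simp add: region_def)
    then obtain a b c d where abcd: "0 \<le> b" "0 \<le> c" "0 \<le> d"
      and eq: "geodesic g A (\<phi> n) t = a *\<^sub>R A + (b *\<^sub>R B + c *\<^sub>R C + d *\<^sub>R D)"
      unfolding convex_cone_hull_insert[of A] convex_cone_hull_3 by blast
    define m where "m = (b * gsin g x) *\<^sub>R u + (c * gsin g y) *\<^sub>R v + (d * gsin g z) *\<^sub>R w"
    have "gcos g t *\<^sub>R A + \<phi> (gsin g t *\<^sub>R n)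
        = (a + b * gcos g x + c * gcos g y + d * gcos g z) *\<^sub>R A + \<phi> m"
      using eq unfolding B C D m_def geodesic_eq by (simp add: l algebra_simps)
    then have "gsin g t *\<^sub>R n = m"
      by (rule tangent_decomposition_unique(2)[OF A \<phi>])
    then have "n = (1 / gsin g t) *\<^sub>R m"
      using t(1) by auto
    moreover have "m \<in> convex_cone hull {u, v, w}"
      unfolding m_def using abcd B(2) C(2) D(2)
      by (intro convex_cone_hull_add convex_cone_hull_mul hull_inc) auto
    ultimately show "n \<in> convex_cone hull {u, v, w}"
      using t(1) by (auto intro: convex_cone_hull_mul)
  next
    assume "n \<in> convex_cone hull {u, v, w}"
    then obtain b c d where bcd: "0 \<le> b" "0 \<le> c" "0 \<le> d" and neq: "n = b *\<^sub>R u + c *\<^sub>R v + d *\<^sub>R w"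
      unfolding convex_cone_hull_3 by blast
    \<comment> \<open>The coefficient at \<open>A\<close> that \<open>n\<close> loses when it is written in terms of the four vertices.\<close>
    define k where "k = b * gcos g x / gsin g x + c * gcos g y / gsin g y + d * gcos g z / gsin g z"
    have dir: "\<phi> n = (b / gsin g x) *\<^sub>R B + (c / gsin g y) *\<^sub>R C + (d / gsin g z) *\<^sub>R D - k *\<^sub>R A"
      using B(2) C(2) D(2) unfolding B(1) C(1) D(1) geodesic_eq neq k_def
      by (simp add: l algebra_simps)
    have "((\<lambda>t. gcos g t - gsin g t * k) \<longlongrightarrow> 1 - 0 * k) (at_right 0)"
      by (intro tendsto_intros gcos_gsin_tendsto)
    then have "\<forall>\<^sub>F t in at_right 0. 0 < gcos g t - gsin g t * k"
      by (rule order_tendstoD) simp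
    moreover have "\<forall>\<^sub>F t in at_right 0. geodesic g A (\<phi> n) t \<in> points g"
      using eventually_geodesic_in_points[OF A] n unit by blast
    ultimately show "\<forall>\<^sub>F t in at_right 0. geodesic g A (\<phi> n) t \<in> region g A B C D"
      using eventually_gsin_pos[of g]
    proof eventually_elim
      case (elim t)
      have "geodesic g A (\<phi> n) t = (gcos g t - gsin g t * k) *\<^sub>R A + ((gsin g t * (b / gsin g x)) *\<^sub>R B
          + (gsin g t * (c / gsin g y)) *\<^sub>R C + (gsin g t * (d / gsin g z)) *\<^sub>R D)"
        unfolding geodesic_eq dir by (simp add: algebra_simps)
      also have "\<dots> \<in> convex_cone hull {A, B, C, D}"
        using elim bcd B(2) C(2) D(2)
        by (intro convex_cone_hull_add convex_cone_hull_mul hull_inc) auto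
      finally show ?case
        using elim by (simp add: region_def)
    qed
  qed
  then show ?thesis
    using unit by (auto simp: inward_directions_def)
qed

lemma sphere_area_cone:
  fixes u :: "real^3"
  assumes "convex_cone S" "u \<in> S" "u \<bullet> u = 1"
  shows "sphere_area (sphere 0 1 \<inter> S) = 3 * ball_volume S"
proof -
  have "{r *\<^sub>R v | r v. 0 \<le> r \<and> r \<le> 1 \<and> v \<in> sphere 0 1 \<inter> S} = cball 0 1 \<inter> S" (is "?L = ?R")
  proof
    show "?L \<subseteq> ?R"
      using assms(1) by (auto simp: convex_cone_iff)
    show "?R \<subseteq> ?L"
    proof
      fix x
      assume x: "x \<in> ?R"
      show "x \<in> ?L"
      proof (cases "x = 0")
        case True
        then have "x = 0 *\<^sub>R u \<and> 0 \<le> (0::real) \<and> (0::real) \<le> 1 \<and> u \<in> sphere 0 1 \<inter> S"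
          using assms by (simp add: norm_eq_1)
        then show ?thesis
          by blast
      next
        case False
        then have "x = norm x *\<^sub>R ((1 / norm x) *\<^sub>R x) \<and> 0 \<le> norm x \<and> norm x \<le> 1
            \<and> (1 / norm x) *\<^sub>R x \<in> sphere 0 1 \<inter> S"
          using x assms(1) by (auto simp: convex_cone_iff)
        then show ?thesis
          by blast
      qed
    qed
  qed
  then show ?thesis
    by (simp add: sphere_area_def ball_volume_def)
qed

lemma triple_product_nonzero:
  fixes u v w :: "real^3"
  assumes "\<And>n. n \<in> span {u, v, w}"
  shows "u \<bullet> cross3 v w \<noteq> 0"
proof
  assume "u \<bullet> cross3 v w = 0"
  then have "det (vector [u, v, w] :: real^3^3) = 0"
    by (simp add: dot_cross_det)
  then have "\<not> inj ((*v) (vector [u, v, w] :: real^3^3))"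
    using det_nz_iff_inj[OF matrix_vector_mul_linear[of "vector [u, v, w] :: real^3^3"]] by simp
  then obtain n where n: "n \<noteq> 0" "(vector [u, v, w] :: real^3^3) *v n = 0"
    by (metis inj_matrix_vector_mult linear_injective_0 matrix_vector_mul_linear)
  then have orth: "u \<bullet> n = 0" "v \<bullet> n = 0" "w \<bullet> n = 0"
    by (simp_all add: matrix_vector_mult_def vec_eq_iff forall_3 inner_vec_def sum_3)
  have "orthogonal n n"
    by (rule orthogonal_to_span[OF assms[of n]]) (use orth in \<open>auto simp: orthogonal_def inner_commute\<close>)
  then show False
    using n(1) by (simp add: orthogonal_self)
qed

text \<open>
  The excess of the spherical triangle at a vertex with edges \<open>x\<close>, \<open>a\<close>, \<open>d\<close>, where \<open>b\<close>, \<open>c\<close>, \<open>y\<close> are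
  opposite to \<open>d\<close>, \<open>a\<close>, \<open>x\<close> (that is, \<open>b\<close> joins the ends of \<open>x\<close> and \<open>a\<close>, and so on). Substituting the law
  of cosines into the area formula gives numerator and denominator a common factor
  \<open>gsin g x * gsin g a * gsin g d\<close>, which cancels here.
\<close>

definition excess :: "geometry \<Rightarrow> real \<Rightarrow> real \<Rightarrow> real \<Rightarrow> real \<Rightarrow> real \<Rightarrow> real \<Rightarrow> real" where
  "excess g x a d b c y =
    (let p = half_angle_product g a d y; q = half_angle_product g d x c; r = half_angle_product g x a b
     in 2 * arccos ((p * gsin g x + q * gsin g a + r * gsin g d - 2 * gsin g x * gsin g a * gsin g d)
          / sqrt (2 * (p * q * r))))"

text \<open>
  The area formula for the spherical triangle of directions, with its three sides computed by the law of cosines.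
\<close>

lemma solid_angle_eq_excess:
  assumes tet: "tetrahedron g A B C D"
  shows "solid_angle g (region g A B C D) A =
    excess g (gdist g A B) (gdist g A C) (gdist g A D) (gdist g B C) (gdist g B D) (gdist g C D)"
proof -
  have pts: "A \<in> points g" "B \<in> points g" "C \<in> points g" "D \<in> points g"
    and dist: "distinct [A, B, C, D]" and ind: "independent {A, B, C, D}"
    using tet by (auto simp: tetrahedron_iff_independent)
  have notin: "X \<notin> span {A}" if "X \<in> {B, C, D}" for X
  proof
    assume "X \<in> span {A}"
    moreover have "{A} \<subseteq> {A, B, C, D} - {X}"
      using that dist by auto
    ultimately have "X \<in> span ({A, B, C, D} - {X})"
      using span_mono by blast
    then show False
      using ind that unfolding dependent_def by blast
  qed
  have full: "span {A, B, C, D} = UNIV"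
  proof -
    have "card {A, B, C, D} = 4"
      using dist by simp
    then show ?thesis
      using card_ge_dim_independent[of "{A, B, C, D}" UNIV] ind by auto
  qed
  define \<phi> where "\<phi> = (SOME \<phi>. tangent_frame g A \<phi>)"
  have \<phi>: "tangent_frame g A \<phi>"
    unfolding \<phi>_def using tangent_frame_exists[OF pts(1)] by (rule someI_ex)
  have lin: "linear \<phi>"
    using \<phi> by (simp add: tangent_frame_def)
  let ?x = "gdist g A B" and ?a = "gdist g A C" and ?d = "gdist g A D"
  obtain u where u: "u \<bullet> u = 1" "B = geodesic g A (\<phi> u) ?x" "0 < gsin g ?x"
    using point_eq_geodesic[OF pts(1,2) notin \<phi>] by blast
  obtain v where v: "v \<bullet> v = 1" "C = geodesic g A (\<phi> v) ?a" "0 < gsin g ?a"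
    using point_eq_geodesic[OF pts(1,3) notin \<phi>] by blast
  obtain w where w: "w \<bullet> w = 1" "D = geodesic g A (\<phi> w) ?d" "0 < gsin g ?d"
    using point_eq_geodesic[OF pts(1,4) notin \<phi>] by blast
  have "n \<in> span {u, v, w}" for n
  proof -
    have "\<phi> n \<in> span {A, B, C, D}"
      using full by simp
    then obtain a b c d where "\<phi> n = a *\<^sub>R A + b *\<^sub>R B + c *\<^sub>R C + d *\<^sub>R D"
      by (auto simp: span_insert algebra_simps)
    also have "\<dots> = a *\<^sub>R A + b *\<^sub>R (gcos g ?x *\<^sub>R A + gsin g ?x *\<^sub>R \<phi> u)
        + c *\<^sub>R (gcos g ?a *\<^sub>R A + gsin g ?a *\<^sub>R \<phi> v) + d *\<^sub>R (gcos g ?d *\<^sub>R A + gsin g ?d *\<^sub>R \<phi> w)"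
      using u(2) v(2) w(2) unfolding geodesic_eq by simp
    finally have "0 *\<^sub>R A + \<phi> n = (a + b * gcos g ?x + c * gcos g ?a + d * gcos g ?d) *\<^sub>R A
        + \<phi> ((b * gsin g ?x) *\<^sub>R u + (c * gsin g ?a) *\<^sub>R v + (d * gsin g ?d) *\<^sub>R w)"
      by (simp add: linear_add[OF lin] linear_cmul[OF lin] algebra_simps)
    then have "n = (b * gsin g ?x) *\<^sub>R u + (c * gsin g ?a) *\<^sub>R v + (d * gsin g ?d) *\<^sub>R w"
      by (rule tangent_decomposition_unique(2)[OF pts(1) \<phi>])
    also have "\<dots> \<in> span {u, v, w}"
      by (intro span_add span_scale span_base) auto
    finally show ?thesis .
  qed
  then have trip: "u \<bullet> cross3 v w \<noteq> 0"
    by (rule triple_product_nonzero)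
  define p q r where "p = v \<bullet> w" and "q = w \<bullet> u" and "r = u \<bullet> v"
  define P Q R where "P = half_angle_product g ?a ?d (gdist g C D)"
    and "Q = half_angle_product g ?d ?x (gdist g B D)" and "R = half_angle_product g ?x ?a (gdist g B C)"
  define S where "S = gsin g ?x * gsin g ?a * gsin g ?d"
  have S: "0 < S"
    using u v w by (simp add: S_def)
  have law: "(1 + p) * (gsin g ?a * gsin g ?d) = P" "(1 + q) * (gsin g ?d * gsin g ?x) = Q"
    "(1 + r) * (gsin g ?x * gsin g ?a) = R"
    unfolding p_def q_def r_def P_def Q_def R_def
    using law_of_cosines[OF pts(1,3,4) \<phi> v(1,2) w(1,2) refl] law_of_cosines[OF pts(1,2,3) \<phi> u(1,2) v(1,2) refl]
      law_of_cosines[OF pts(1,4,2) \<phi> w(1,2) u(1,2) gdist_commute]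
    by simp_all
  have "solid_angle g (region g A B C D) A = sphere_area (sphere 0 1 \<inter> convex_cone hull {u, v, w})"
    unfolding solid_angle_def \<phi>_def[symmetric]
    using inward_directions_eq_cone[OF pts(1) \<phi> u(2,3) v(2,3) w(2,3)] by simp
  also have "\<dots> = 3 * ball_volume (convex_cone hull {u, v, w})"
    using u(1) by (intro sphere_area_cone[of _ u] convex_cone_convex_cone_hull) (auto intro: hull_inc)
  also have "\<dots> = 2 * arccos ((1 + p + q + r) / sqrt (2 * ((1 + p) * (1 + q) * (1 + r))))"
    using ball_volume_cone[OF u(1) v(1) w(1) trip p_def q_def r_def] by simp
  also have "(1 + p + q + r) / sqrt (2 * ((1 + p) * (1 + q) * (1 + r)))
      = (S * (1 + p + q + r)) / sqrt (2 * (P * Q * R))"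
  proof -
    have "P * Q * R = S^2 * ((1 + p) * (1 + q) * (1 + r))"
      unfolding law[symmetric] S_def by (simp add: power2_eq_square mult_ac)
    then have "sqrt (2 * (P * Q * R)) = S * sqrt (2 * ((1 + p) * (1 + q) * (1 + r)))"
      using S by (simp add: real_sqrt_mult)
    then show ?thesis
      using S by simp
  qed
  also have "S * (1 + p + q + r) = P * gsin g ?x + Q * gsin g ?a + R * gsin g ?d - 2 * gsin g ?x * gsin g ?a * gsin g ?d"
    unfolding law[symmetric] S_def by (simp add: algebra_simps)
  finally show ?thesis
    unfolding excess_def Let_def P_def Q_def R_def .
qed

section \<open>Invariance under the exchange of edge lengths\<close>

text \<open>
  The numerator and the radicand of \<open>excess\<close> are invariant separately. The radicand is a product of six
  values of \<open>gsin\<close> and a constant, and the arguments are permuted. In the numerator, the term with \<open>y\<close>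
  is fixed. In the curved geometries, the product-to-sum formulas turn the rest into a combination of
  values of \<open>gsin\<close> at \<open>a + c\<close>, \<open>a - c\<close>, \<open>d + b\<close>, \<open>d - b\<close> and \<open>a + d\<close>, which the exchange also permutes.
\<close>

lemma excess_regge:
  assumes s: "s = (a + b + c + d) / 2"
  shows "excess g x a d b c y = excess g x (s - b) (s - c) (s - a) (s - d) y"
proof -
  let ?h = "half_angle_product g"
  have P: "?h (s - b) (s - c) y = ?h a d y"
  proof -
    have "s - b + (s - c) = a + d"
      by (simp add: s field_simps)
    then show ?thesis
      by (simp add: half_angle_product_def)
  qed
  have QR: "?h (s - c) x (s - d) * ?h x (s - b) (s - a) = ?h d x c * ?h x a b"
  proof -
    have "s - c + x + (s - d) = x + a + b" "s - c + x - (s - d) = d + x - c"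
      "x + (s - b) + (s - a) = d + x + c" "x + (s - b) - (s - a) = x + a - b"
      by (simp_all add: s field_simps)
    then show ?thesis
      unfolding half_angle_product_def by (simp only:) (simp add: mult_ac)
  qed
  have N: "?h d x c * gsin g a + ?h x a b * gsin g d - 2 * gsin g x * gsin g a * gsin g d
      = ?h (s - c) x (s - d) * gsin g (s - b) + ?h x (s - b) (s - a) * gsin g (s - c)
        - 2 * gsin g x * gsin g (s - b) * gsin g (s - c)"
  proof -
    have args: "s - b + (s - d) = a + c" "s - b - (s - d) = d - b" "s - c + (s - a) = d + b"
      "s - c - (s - a) = a - c" "s - b + (s - c) = a + d"
      by (simp_all add: s field_simps)
    show ?thesis
    proof (cases g)
      case Spherical
      have "?h d x c * gsin g a + ?h x a b * gsin g d - 2 * gsin g x * gsin g a * gsin g d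
        = (sin (a + c) + sin (a - c) + sin (d + b) + sin (d - b)) / 2 - cos x * sin (a + d)" for a b c d
        unfolding Spherical half_angle_product_Spherical gsin.simps
        by (simp add: sin_add sin_diff cos_add algebra_simps)
      then show ?thesis
        by (simp only: args) simp
    next
      case Hyperbolic
      have "?h d x c * gsin g a + ?h x a b * gsin g d - 2 * gsin g x * gsin g a * gsin g d
        = cosh x * sinh (a + d) - (sinh (a + c) + sinh (a - c) + sinh (d + b) + sinh (d - b)) / 2" for a b c d
        unfolding Hyperbolic half_angle_product_Hyperbolic gsin.simps
        by (simp add: sinh_add sinh_diff cosh_add algebra_simps)
      then show ?thesis
        by (simp only: args) simp
    next
      case Euclidean
      then show ?thesis
        unfolding s half_angle_product_def by (simp add: field_simps power2_eq_square)
    qed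
  qed
  have num: "?h a d y * gsin g x + ?h d x c * gsin g a + ?h x a b * gsin g d - 2 * gsin g x * gsin g a * gsin g d
      = ?h (s - b) (s - c) y * gsin g x + ?h (s - c) x (s - d) * gsin g (s - b)
        + ?h x (s - b) (s - a) * gsin g (s - c) - 2 * gsin g x * gsin g (s - b) * gsin g (s - c)"
    using N unfolding P by linarith
  have den: "?h (s - b) (s - c) y * ?h (s - c) x (s - d) * ?h x (s - b) (s - a) = ?h a d y * ?h d x c * ?h x a b"
    unfolding P using QR by (simp add: mult.assoc)
  show ?thesis
    unfolding excess_def Let_def num den ..
qed

text \<open>
  It suffices to treat one vertex: relabelling the vertices moves any of the four to the place of
  \<open>F\<^sub>1\<close>, and the hypotheses are symmetric under the relabellings used.
\<close>

lemma solid_angle_regge: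
  assumes "tetrahedron g F\<^sub>1 F\<^sub>2 K L"
    and "gdist g F\<^sub>1 F\<^sub>2 = x" and "gdist g K L = y"
    and "gdist g F\<^sub>1 K = a" and "gdist g F\<^sub>2 K = b"
    and "gdist g F\<^sub>2 L = c" and "gdist g F\<^sub>1 L = d"
    and "s = (a + b + c + d) / 2"
    and "tetrahedron g G\<^sub>1 G\<^sub>2 M N"
    and "gdist g G\<^sub>1 G\<^sub>2 = x" and "gdist g M N = y"
    and "gdist g G\<^sub>1 M = s - a" and "gdist g G\<^sub>2 M = s - b"
    and "gdist g G\<^sub>2 N = s - c" and "gdist g G\<^sub>1 N = s - d"
  shows "solid_angle g (region g F\<^sub>1 F\<^sub>2 K L) F\<^sub>1 = solid_angle g (region g G\<^sub>1 G\<^sub>2 M N) G\<^sub>2"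
proof -
  have "tetrahedron g G\<^sub>2 G\<^sub>1 M N" "region g G\<^sub>2 G\<^sub>1 M N = region g G\<^sub>1 G\<^sub>2 M N"
    using assms(9) by (simp_all add: tetrahedron_def region_def insert_commute)
  then show ?thesis
    using solid_angle_eq_excess[OF assms(1)] solid_angle_eq_excess[of g G\<^sub>2 G\<^sub>1 M N] excess_regge[OF assms(8)]
      gdist_commute[of g G\<^sub>2 G\<^sub>1] assms by simp
qed

theorem mainTheorem3:
  fixes g :: geometry
    and F\<^sub>1 F\<^sub>2 K L G\<^sub>1 G\<^sub>2 M N :: "real^4"
    and x y a b c d s :: real
  assumes "tetrahedron g F\<^sub>1 F\<^sub>2 K L"
    and "gdist g F\<^sub>1 F\<^sub>2 = x" and "gdist g K L = y"
    and "gdist g F\<^sub>1 K = a" and "gdist g F\<^sub>2 K = b"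
    and "gdist g F\<^sub>2 L = c" and "gdist g F\<^sub>1 L = d"
    and "s = (a + b + c + d) / 2"
    and "tetrahedron g G\<^sub>1 G\<^sub>2 M N"
    and "gdist g G\<^sub>1 G\<^sub>2 = x" and "gdist g M N = y"
    and "gdist g G\<^sub>1 M = s - a" and "gdist g G\<^sub>2 M = s - b"
    and "gdist g G\<^sub>2 N = s - c" and "gdist g G\<^sub>1 N = s - d"
  shows "solid_angle g (region g F\<^sub>1 F\<^sub>2 K L) F\<^sub>1 = solid_angle g (region g G\<^sub>1 G\<^sub>2 M N) G\<^sub>2
    \<and> solid_angle g (region g F\<^sub>1 F\<^sub>2 K L) F\<^sub>2 = solid_angle g (region g G\<^sub>1 G\<^sub>2 M N) G\<^sub>1
    \<and> solid_angle g (region g F\<^sub>1 F\<^sub>2 K L) K = solid_angle g (region g G\<^sub>1 G\<^sub>2 M N) N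
    \<and> solid_angle g (region g F\<^sub>1 F\<^sub>2 K L) L = solid_angle g (region g G\<^sub>1 G\<^sub>2 M N) M"
proof -
  have tet: "tetrahedron g F\<^sub>2 F\<^sub>1 K L" "tetrahedron g K L F\<^sub>1 F\<^sub>2" "tetrahedron g L K F\<^sub>1 F\<^sub>2"
    "tetrahedron g G\<^sub>2 G\<^sub>1 M N" "tetrahedron g M N G\<^sub>1 G\<^sub>2" "tetrahedron g N M G\<^sub>1 G\<^sub>2"
    using assms(1,9) by (simp_all add: tetrahedron_def insert_commute)
  have reg: "region g F\<^sub>2 F\<^sub>1 K L = region g F\<^sub>1 F\<^sub>2 K L" "region g K L F\<^sub>1 F\<^sub>2 = region g F\<^sub>1 F\<^sub>2 K L"
    "region g L K F\<^sub>1 F\<^sub>2 = region g F\<^sub>1 F\<^sub>2 K L" "region g G\<^sub>2 G\<^sub>1 M N = region g G\<^sub>1 G\<^sub>2 M N"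
    "region g M N G\<^sub>1 G\<^sub>2 = region g G\<^sub>1 G\<^sub>2 M N" "region g N M G\<^sub>1 G\<^sub>2 = region g G\<^sub>1 G\<^sub>2 M N"
    by (simp_all add: region_def insert_commute)
  have F: "gdist g F\<^sub>2 F\<^sub>1 = x" "gdist g L K = y" "gdist g K F\<^sub>1 = a" "gdist g K F\<^sub>2 = b"
    "gdist g L F\<^sub>2 = c" "gdist g L F\<^sub>1 = d"
    using assms(2-7) gdist_commute[of g F\<^sub>2 F\<^sub>1] gdist_commute[of g L K] gdist_commute[of g K F\<^sub>1]
      gdist_commute[of g K F\<^sub>2] gdist_commute[of g L F\<^sub>2] gdist_commute[of g L F\<^sub>1] by simp_all
  have G: "gdist g G\<^sub>2 G\<^sub>1 = x" "gdist g N M = y" "gdist g M G\<^sub>1 = s - a" "gdist g M G\<^sub>2 = s - b"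
    "gdist g N G\<^sub>2 = s - c" "gdist g N G\<^sub>1 = s - d"
    using assms(10-15) gdist_commute[of g G\<^sub>2 G\<^sub>1] gdist_commute[of g N M] gdist_commute[of g M G\<^sub>1]
      gdist_commute[of g M G\<^sub>2] gdist_commute[of g N G\<^sub>2] gdist_commute[of g N G\<^sub>1] by simp_all
  have s: "s = (b + a + d + c) / 2" "s = (a + d + c + b) / 2" "s = (d + a + b + c) / 2"
    using assms(8) by simp_all
  show ?thesis
    using solid_angle_regge[OF assms]
      solid_angle_regge[OF tet(1) F(1) assms(3,5,4,7,6) s(1) tet(4) G(1) assms(11,13,12,15,14)]
      solid_angle_regge[OF tet(2) assms(3,2) F(3,6,5,4) s(2) tet(5) assms(11,10) G(3,6,5,4)]
      solid_angle_regge[OF tet(3) F(2) assms(2) F(6,3,4,5) s(3) tet(6) G(2) assms(10) G(6,3,4,5)]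
    unfolding reg by blast
qed

end
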